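(* Let $A$, $A_1$, $B$, $B_1$, $B_2$, $C_1$, $C_1-A_1$ and $\mathbb{Y}$ be positive stable matrices in $\mathbb{C}^{r\times r}$ such that $A$, $A_1$, $B$, $C_1$, $\mathbb{Y}$ commute with each other and $B_1B_2=B_2B_1$. Then for all integers $m,n\ge0$ and all $z,w\in\mathbb{C}$ with $|z|<1$, $|w|<1$, $$\begin{aligned}\frac{\partial^{m+n}}{\partial z^m\,\partial w^n}&F_1^{(A,B)}(A_1,B_1,B_2;C_1;z,w;\mathbb{Y})\\&=(A_1)_{m+n}(C_1)_{m+n}^{-1}\,F_1^{(A,B)}(A_1+(m+n)I,B_1+mI,B_2+nI;C_1+(m+n)I;z,w;\mathbb{Y})\,(B_1)_m(B_2)_n.\end{aligned}$$
   Context: A matrix in $\mathbb{C}^{r\times r}$ is positive stable if all its eigenvalues have positive real part; $I$ is the identity matrix. For $t>0$ and a square matrix $M$, $t^M=\exp(M\ln t)$. The Pochhammer symbol is $(M)_0=I$, $(M)_n=M(M+I)\cdots(M+(n-1)I)$ for $n\ge1$, and $(M)_n^{-1}$ is the inverse of $(M)_n$. For positive stable $B$ and a square matrix $W$, ${}_1F_1(A;B;W)=\sum_{n\ge0}(A)_n\,(B)_n^{-1}\,\frac{W^n}{n!}$. For commuting positive stable $P,Q$, the beta matrix function is $\mathfrak{B}(P,Q)=\Gamma(P)\Gamma(Q)\Gamma^{-1}(P+Q)=\int_0^1t^{P-I}(1-t)^{Q-I}dt$, where $\Gamma(P)=\int_0^\infty e^{-t}t^{P-I}dt$. For positive stable $A,B,P,Q,\mathbb{Y}$,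 $$\mathfrak{B}_{\mathbb{Y}}^{(A,B)}(P,Q)=\int_0^1 {}_1F_1\!\left(A;B;-\frac{\mathbb{Y}}{t(1-t)}\right)t^{P-I}(1-t)^{Q-I}\,dt .$$ The new extended Appell matrix function is $$F_1^{(A,B)}(A_1,B_1,B_2;C_1;z,w;\mathbb{Y})=\sum_{m,n\ge0}\mathfrak{B}_{\mathbb{Y}}^{(A,B)}(A_1+(m+n)I,C_1-A_1)\,[\mathfrak{B}(A_1,C_1-A_1)]^{-1}(B_1)_m(B_2)_n\frac{z^mw^n}{m!\,n!}.$$ *)

theory Defs
  imports "HOL-Analysis.Analysis"
begin

text \<open>
  Matrices in \<open>\<complex>\<^bsup>r\<times>r\<^esup>\<close> are elements of \<^typ>\<open>complex^'r^'r\<close>. The operations \<open>*\<close>, \<open>^\<close>, \<open>exp\<close> on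
  this type, where they exist at all, are componentwise, so powers and exponentials are defined
  here from the matrix product \<open>**\<close>. The matrix \<open>c I\<close> is \<open>mat c\<close>.
\<close>

definition cscale :: "complex \<Rightarrow> complex^'n^'m \<Rightarrow> complex^'n^'m" (infixr "*\<^sub>C" 75)
  where "c *\<^sub>C M = map_matrix (\<lambda>x. c * x) M"

definition positive_stable :: "complex^'r^'r \<Rightarrow> bool"
  where "positive_stable M \<longleftrightarrow> (\<forall>\<mu> v. v \<noteq> 0 \<and> M *v v = \<mu> *s v \<longrightarrow> 0 < Re \<mu>)"

primrec matpow :: "complex^'r^'r \<Rightarrow> nat \<Rightarrow> complex^'r^'r"
  where
    "matpow M 0 = mat 1"
  | "matpow M (Suc n) = matpow M n ** M"

definition matexp :: "complex^'r^'r \<Rightarrow> complex^'r^'r"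
  where "matexp M = (\<Sum>n. (1 / fact n) *\<^sub>R matpow M n)"

text \<open>\<open>t\<^bsup>M\<^esup>\<close>, for \<open>t > 0\<close>\<close>

definition rpow :: "real \<Rightarrow> complex^'r^'r \<Rightarrow> complex^'r^'r"
  where "rpow t M = matexp (ln t *\<^sub>R M)"

primrec matpoch :: "complex^'r^'r \<Rightarrow> nat \<Rightarrow> complex^'r^'r"
  where
    "matpoch M 0 = mat 1"
  | "matpoch M (Suc n) = matpoch M n ** (M + mat (of_nat n))"

definition hyp1F1 :: "complex^'r^'r \<Rightarrow> complex^'r^'r \<Rightarrow> complex^'r^'r \<Rightarrow> complex^'r^'r"
  where "hyp1F1 A B W =
    (\<Sum>n. (1 / fact n) *\<^sub>R (matpoch A n ** matrix_inv (matpoch B n) ** matpow W n))"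

definition matGamma :: "complex^'r^'r \<Rightarrow> complex^'r^'r"
  where "matGamma P = integral {0<..} (\<lambda>t. exp (- t) *\<^sub>R rpow t (P - mat 1))"

text \<open>
  Only meaningful for commuting positive stable \<open>P\<close> and \<open>Q\<close>; then it equals
  \<open>\<integral>\<^sub>0\<^sup>1 t\<^bsup>P-I\<^esup> (1-t)\<^bsup>Q-I\<^esup> dt\<close>.
\<close>

definition matBeta :: "complex^'r^'r \<Rightarrow> complex^'r^'r \<Rightarrow> complex^'r^'r"
  where "matBeta P Q = matGamma P ** matGamma Q ** matrix_inv (matGamma (P + Q))"

definition extBeta ::
    "complex^'r^'r \<Rightarrow> complex^'r^'r \<Rightarrow> complex^'r^'r \<Rightarrow> complex^'r^'r \<Rightarrow> complex^'r^'r \<Rightarrow> complex^'r^'r"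
  where "extBeta A B Y P Q = integral {0<..<1}
    (\<lambda>t. hyp1F1 A B (- ((1 / (t * (1 - t))) *\<^sub>R Y)) ** rpow t (P - mat 1) ** rpow (1 - t) (Q - mat 1))"

text \<open>
  The argument order is that of \<open>F\<^sub>1\<^bsup>(A,B)\<^esup>(A1, B1, B2; C1; z, w; Y)\<close>.  The double series is an
  unordered sum over \<open>\<nat> \<times> \<nat>\<close>.
\<close>

definition extF1 ::
    "complex^'r^'r \<Rightarrow> complex^'r^'r \<Rightarrow> complex^'r^'r \<Rightarrow> complex^'r^'r \<Rightarrow> complex^'r^'r \<Rightarrow>
     complex^'r^'r \<Rightarrow> complex \<Rightarrow> complex \<Rightarrow> complex^'r^'r \<Rightarrow> complex^'r^'r"
  where "extF1 A B A1 B1 B2 C1 z w Y =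
    (\<Sum>\<^sub>\<infinity>(m, n)\<in>UNIV. (z ^ m * w ^ n / (fact m * fact n)) *\<^sub>C
      (extBeta A B Y (A1 + mat (of_nat (m + n))) (C1 - A1) ** matrix_inv (matBeta A1 (C1 - A1))
        ** matpoch B1 m ** matpoch B2 n))"

text \<open>
  \<open>has_nth_deriv n f z D\<close>: the matrix-valued function \<open>f\<close> of a complex variable is \<open>n\<close> times complex
  differentiable at \<open>z\<close> (in particular, \<open>n - 1\<close> times in a neighbourhood of \<open>z\<close>), with \<open>n\<close>-th
  derivative \<open>D\<close>.  A relation is used, rather than a derivative operator, so that existence of all the
  derivatives involved is part of the assertion.
\<close>

primrec has_nth_deriv ::
    "nat \<Rightarrow> (complex \<Rightarrow> complex^'r^'r) \<Rightarrow> complex \<Rightarrow> complex^'r^'r \<Rightarrow> bool"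
  where
    "has_nth_deriv 0 f z D \<longleftrightarrow> D = f z"
  | "has_nth_deriv (Suc n) f z D \<longleftrightarrow>
      (\<exists>g. (\<forall>\<^sub>F x in nhds z. has_nth_deriv n f x (g x)) \<and>
        (g has_derivative (\<lambda>h. h *\<^sub>C D)) (at z))"

text \<open>
  \<open>\<partial>\<^bsup>m+n\<^esup>F/\<partial>z\<^bsup>m\<^esup>\<partial>w\<^bsup>n\<^esup>\<close> exists at \<open>(z, w)\<close> and equals \<open>D\<close>; it is taken as
  \<open>\<partial>\<^bsup>m\<^esup>/\<partial>z\<^bsup>m\<^esup> (\<partial>\<^bsup>n\<^esup>F/\<partial>w\<^bsup>n\<^esup>)\<close>.
\<close>

definition has_mixed_partial ::
    "nat \<Rightarrow> nat \<Rightarrow> (complex \<Rightarrow> complex \<Rightarrow> complex^'r^'r) \<Rightarrow> complex \<Rightarrow> complex \<Rightarrow> complex^'r^'r \<Rightarrow> bool"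
  where "has_mixed_partial m n F z w D \<longleftrightarrow>
    (\<exists>G. (\<forall>\<^sub>F x in nhds z. has_nth_deriv n (F x) w (G x)) \<and> has_nth_deriv m G z D)"

lemma cscale_one [simp]: "1 *\<^sub>C D = D"
  by (simp add: cscale_def map_matrix_def)

lemma has_nth_deriv_unique_cong:
  assumes "has_nth_deriv n f z D" "has_nth_deriv n g z E" "\<forall>\<^sub>F x in nhds z. f x = g x"
  shows "D = E"
  using assms
proof (induction n arbitrary: z D E)
  case 0
  then show ?case by (auto dest: eventually_nhds_x_imp_x)
next
  case (Suc n)
  obtain f' where f': "\<forall>\<^sub>F x in nhds z. has_nth_deriv n f x (f' x)"
      "(f' has_derivative (\<lambda>h. h *\<^sub>C D)) (at z)"
    using Suc.prems(1) by auto
  obtain g' where g': "\<forall>\<^sub>F x in nhds z. has_nth_deriv n g x (g' x)"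
      "(g' has_derivative (\<lambda>h. h *\<^sub>C E)) (at z)"
    using Suc.prems(2) by auto
  have "\<forall>\<^sub>F x in nhds z. \<forall>\<^sub>F y in nhds x. f y = g y"
    using Suc.prems(3) by (simp add: eventually_eventually)
  with f'(1) g'(1) have ev: "\<forall>\<^sub>F x in nhds z. f' x = g' x"
    by eventually_elim (use Suc.IH in blast)
  have "(g' has_derivative (\<lambda>h. h *\<^sub>C D)) (at z)"
    using has_derivative_transform_eventually[OF f'(2), of g']
      eventually_nhds_x_imp_x[OF ev] eventually_mono[OF ev]
    by (simp add: eventually_at_filter)
  then have "(\<lambda>h. h *\<^sub>C D) = (\<lambda>h. h *\<^sub>C E)"
    using g'(2) by (rule has_derivative_unique)
  then have "1 *\<^sub>C D = 1 *\<^sub>C E" by (rule fun_cong)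
  then show ?case by simp
qed

lemma has_mixed_partial_unique:
  assumes "has_mixed_partial m n F z w D" "has_mixed_partial m n F z w E"
  shows "D = E"
proof -
  obtain G where G: "\<forall>\<^sub>F x in nhds z. has_nth_deriv n (F x) w (G x)" "has_nth_deriv m G z D"
    using assms(1) by (auto simp: has_mixed_partial_def)
  obtain H where H: "\<forall>\<^sub>F x in nhds z. has_nth_deriv n (F x) w (H x)" "has_nth_deriv m H z E"
    using assms(2) by (auto simp: has_mixed_partial_def)
  have "\<forall>\<^sub>F x in nhds z. G x = H x"
    using G(1) H(1) by eventually_elim (rule has_nth_deriv_unique_cong, auto)
  with G(2) H(2) show ?thesis by (rule has_nth_deriv_unique_cong)
qed

end

theory Submission
  imports Defs "HOL-Computational_Algebra.Fundamental_Theorem_Algebra" "HOL-Real_Asymp.Real_Asymp"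
begin

text \<open>
  Differentiating the double series termwise shifts its coefficients from \<open>(j, k)\<close> to
  \<open>(j + m, k + n)\<close>.  Since \<open>(B\<^sub>1)\<^bsub>j+m\<^esub> = (B\<^sub>1)\<^sub>m (B\<^sub>1 + mI)\<^sub>j\<close>, and the extended beta function at
  \<open>(A\<^sub>1 + NI, C\<^sub>1 - A\<^sub>1)\<close> commutes with \<open>A\<^sub>1\<close> and \<open>C\<^sub>1\<close>, everything reduces to
  \<open>(A\<^sub>1)\<^sub>N (C\<^sub>1)\<^sub>N\<^sup>-\<^sup>1 \<BB>(A\<^sub>1 + NI, Q)\<^sup>-\<^sup>1 = \<BB>(A\<^sub>1, Q)\<^sup>-\<^sup>1\<close>, that is, to \<open>\<Gamma>(P + I) = P \<Gamma>(P)\<close> and the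
  invertibility of \<open>\<Gamma>(P)\<close> for positive stable \<open>P\<close>.

  Termwise differentiation only needs the extended beta values to be bounded in \<open>N\<close>, and this is
  true whether or not the defining integrals exist: they are the moments \<open>\<integral> t\<^sup>N f(t) dt\<close> of one
  function on \<open>(0, 1)\<close>, so that no asymptotics of \<open>\<^sub>1F\<^sub>1\<close> is required.
\<close>

section \<open>Matrix algebra and the matrix exponential\<close>

text \<open>The analytic obstacle is the behaviour of \<open>rpow t P\<close> near 0. Positive
  stability speaks of eigenvalues, while integrability of t^(P-I) needs a norm bound by C
  t^\<epsilon> with \<epsilon> > 0, and \<open>P\<close> may fail to be diagonalizable. Instead of a
  Jordan form, some nonzero polynomial annihilating \<open>P\<close> is split into linear factors,
  and the factors whose roots are not eigenvalues are cancelled. This factored annihilator serves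
  twice: it drives the decay estimate, and it yields an eigenvector inside the kernel of the gamma
  matrix. Powers t^P are identified through the equation t X' = Q X with X(1) = I, so exponential
  series are never multiplied. The order of factors is rigid: \<open>B1\<close> and
  \<open>B2\<close> are not assumed to commute with \<open>A1\<close> or \<open>C1\<close>. The
  Pochhammer factors of \<open>B1\<close> and \<open>B2\<close> therefore stay on the right, the
  prefactor stays on the left, and the latter reaches the inverse beta factor only by passing
  through the extended beta value.\<close>

lemma norm_matrix_mult_le:
  fixes A :: "complex^'n^'m" and B :: "complex^'p^'n"
  shows "norm (A ** B) \<le> norm A * norm B"
proof -
  define c where "c j = L2_set (\<lambda>k. norm (B $ k $ j)) UNIV" for j
  have entry: "norm ((A ** B) $ i $ j) \<le> norm (A $ i) * c j" for i j
  proof -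
    have "norm ((A ** B) $ i $ j) \<le> (\<Sum>k\<in>UNIV. \<bar>norm (A $ i $ k)\<bar> * \<bar>norm (B $ k $ j)\<bar>)"
      by (simp add: matrix_matrix_mult_def norm_mult sum_norm_le)
    also have "\<dots> \<le> L2_set (\<lambda>k. norm (A $ i $ k)) UNIV * L2_set (\<lambda>k. norm (B $ k $ j)) UNIV"
      by (rule L2_set_mult_ineq)
    finally show ?thesis
      by (simp add: norm_vec_def c_def)
  qed
  have row: "norm ((A ** B) $ i) \<le> norm (A $ i) * L2_set c UNIV" for i
  proof -
    have "norm ((A ** B) $ i) = L2_set (\<lambda>j. norm ((A ** B) $ i $ j)) UNIV"
      by (simp add: norm_vec_def)
    also have "\<dots> \<le> L2_set (\<lambda>j. norm (A $ i) * c j) UNIV"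
      by (rule L2_set_mono) (auto intro: entry)
    finally show ?thesis
      by (simp add: L2_set_right_distrib)
  qed
  have "norm (A ** B) = L2_set (\<lambda>i. norm ((A ** B) $ i)) UNIV"
    by (simp add: norm_vec_def)
  also have "\<dots> \<le> L2_set (\<lambda>i. norm (A $ i) * L2_set c UNIV) UNIV"
    by (rule L2_set_mono) (auto intro: row)
  also have "\<dots> = norm A * L2_set c UNIV"
    by (simp add: L2_set_left_distrib norm_vec_def)
  also have "L2_set c UNIV = norm B"
    unfolding c_def norm_vec_def L2_set_def
    by (simp add: sum_nonneg) (subst sum.swap, rule refl)
  finally show ?thesis .
qed

lemma bounded_bilinear_matrix_mult:
  "bounded_bilinear ((**) :: complex^'n^'m \<Rightarrow> complex^'p^'n \<Rightarrow> complex^'p^'m)"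
proof
  show "\<exists>K. \<forall>a b. norm ((a::complex^'n^'m) ** (b::complex^'p^'n)) \<le> norm a * norm b * K"
    by (rule exI[of _ 1]) (simp add: norm_matrix_mult_le)
qed (vector matrix_matrix_mult_def sum.distrib distrib_left distrib_right scaleR_sum_right)+

interpretation matmul: bounded_bilinear
  "(**) :: complex^'n^'m \<Rightarrow> complex^'p^'n \<Rightarrow> complex^'p^'m"
  by (rule bounded_bilinear_matrix_mult)

lemma mat_mult_nth: "(mat c ** M) $ i $ j = c * (M $ i $ j)" for M :: "complex^'n^'m"
  by (simp add: matrix_matrix_mult_def mat_def if_distrib[where f="\<lambda>x. x * _"] cong: if_cong)

lemma mult_mat_nth: "(M ** mat c) $ i $ j = c * (M $ i $ j)" for M :: "complex^'n^'m"
  by (simp add: matrix_matrix_mult_def mat_def if_distrib[where f="\<lambda>x. _ * x"] cong: if_cong)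

text \<open>The analysis on this type uses only its real vector space structure; writing complex
  scaling as a matrix product makes the bilinearity rules apply to it.\<close>

lemma cscale_eq_mat_mult: "c *\<^sub>C M = mat c ** M"
  by (simp add: vec_eq_iff mat_mult_nth cscale_def)

lemma mat_mult_commute: "M ** mat c = mat c ** M" for M :: "complex^'n^'m"
  by (simp add: vec_eq_iff mat_mult_nth mult_mat_nth)

lemma mat_mult_mat: "mat c ** mat d = (mat (c * d) :: complex^'n^'n)"
  by (simp add: vec_eq_iff mat_mult_nth) (simp add: mat_def)

lemma mat_add: "mat (c + d) = (mat c + mat d :: complex^'n^'n)"
  by (simp add: vec_eq_iff mat_def)

lemma mat_of_real_mult: "mat (of_real c) ** M = c *\<^sub>R M" for M :: "complex^'n^'m"
  by (simp add: vec_eq_iff mat_mult_nth) (simp add: scaleR_conv_of_real)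

lemma mat_of_nat_mult: "mat (of_nat k) ** M = real k *\<^sub>R M" for M :: "complex^'n^'m"
  using mat_of_real_mult[of "real k"] by simp

lemma scaleR_matrix_nth: "(c *\<^sub>R M) $ i $ j = of_real c * M $ i $ j" for M :: "complex^'n^'m"
  by (simp add: vector_scaleR_component) (simp add: scaleR_conv_of_real)

lemma norm_cscale: "norm (c *\<^sub>C M) = norm c * norm M"
  by (simp add: cscale_def norm_vec_def norm_mult L2_set_right_distrib)

section \<open>Commutation rules and inverses\<close>

lemma commute_mult:
  fixes X :: "complex^'r^'r"
  assumes "X ** M = M ** X" "X ** N = N ** X"
  shows "X ** (M ** N) = (M ** N) ** X"
  by (metis assms matrix_mul_assoc)

lemma commute_add:
  fixes X :: "complex^'r^'r"
  assumes "X ** M = M ** X" "X ** N = N ** X"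
  shows "X ** (M + N) = (M + N) ** X"
  by (simp add: assms matmul.add_left matmul.add_right)

lemma commute_add_mat:
  fixes X :: "complex^'r^'r"
  assumes "X ** M = M ** X"
  shows "X ** (M + mat c) = (M + mat c) ** X"
  by (intro commute_add assms mat_mult_commute)

lemma commute_scaleR:
  fixes X :: "complex^'r^'r"
  assumes "X ** M = M ** X"
  shows "X ** (c *\<^sub>R M) = (c *\<^sub>R M) ** X"
  by (simp add: assms matmul.scaleR_left matmul.scaleR_right)

lemma commute_matpow:
  assumes "X ** M = M ** X"
  shows "X ** matpow M n = matpow M n ** X"
  by (induction n) (simp_all add: commute_mult assms)

lemma commute_matpoch:
  assumes "X ** M = M ** X"
  shows "X ** matpoch M n = matpoch M n ** X"
  by (induction n) (simp_all add: commute_mult commute_add_mat assms)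

lemma matrix_inv_right: "invertible M \<Longrightarrow> M ** matrix_inv M = mat 1"
  and matrix_inv_left: "invertible M \<Longrightarrow> matrix_inv M ** M = mat 1"
  for M :: "complex^'r^'r"
  unfolding invertible_def matrix_inv_def by (metis (mono_tags, lifting) someI_ex)+

lemma matrix_inv_eqI:
  fixes M :: "complex^'r^'r"
  assumes "M ** N = mat 1"
  shows "matrix_inv M = N"
  by (metis assms invertible_right_inverse matrix_inv_left matrix_mul_assoc matrix_mul_lid
      matrix_mul_rid)

lemma invertible_matrix_inv: "invertible M \<Longrightarrow> invertible (matrix_inv M)"
  for M :: "complex^'r^'r"
  using invertible_def matrix_inv_left matrix_inv_right by metis

lemma matrix_inv_mult:
  fixes M N :: "complex^'r^'r"
  assumes "invertible M" "invertible N"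
  shows "matrix_inv (M ** N) = matrix_inv N ** matrix_inv M"
proof (rule matrix_inv_eqI)
  have "M ** N ** (matrix_inv N ** matrix_inv M) = M ** (N ** matrix_inv N) ** matrix_inv M"
    by (simp only: matrix_mul_assoc)
  then show "M ** N ** (matrix_inv N ** matrix_inv M) = mat 1"
    by (simp add: assms matrix_inv_right)
qed

lemma commute_matrix_inv:
  fixes X :: "complex^'r^'r"
  assumes "X ** M = M ** X" "invertible M"
  shows "X ** matrix_inv M = matrix_inv M ** X"
proof -
  have "X ** matrix_inv M = matrix_inv M ** (M ** X) ** matrix_inv M"
    by (simp add: matrix_mul_assoc matrix_inv_left[OF assms(2)])
  also have "\<dots> = matrix_inv M ** X ** (M ** matrix_inv M)"
    by (simp only: assms(1)[symmetric] matrix_mul_assoc)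
  finally show ?thesis
    by (simp add: matrix_inv_right[OF assms(2)])
qed

lemma suminf_mult_commute:
  fixes X :: "complex^'r^'r"
  assumes "summable f" "\<And>n. X ** f n = f n ** X"
  shows "X ** suminf f = suminf f ** X"
  using bounded_linear.suminf[OF matmul.bounded_linear_right assms(1), of X]
    bounded_linear.suminf[OF matmul.bounded_linear_left assms(1), of X]
  by (simp add: assms(2))

text \<open>The norm of the type is the Frobenius norm, which is submultiplicative but gives the
  identity the norm sqrt r; this is the source of the factor \<open>norm (mat 1)\<close> here and in
  later estimates.\<close>

lemma norm_matpow_le: "norm (matpow M n) \<le> norm (mat 1 :: complex^'r^'r) * norm M ^ n"
  for M :: "complex^'r^'r"
proof (induction n)
  case (Suc n)
  have "norm (matpow M (Suc n)) \<le> norm (matpow M n) * norm M"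
    by (simp add: norm_matrix_mult_le)
  also have "\<dots> \<le> (norm (mat 1 :: complex^'r^'r) * norm M ^ n) * norm M"
    by (intro mult_right_mono Suc) auto
  finally show ?case by (simp add: algebra_simps)
qed simp

lemma matexp_norm_term_le:
  "norm ((1 / fact n) *\<^sub>R matpow M n) \<le> norm (mat 1 :: complex^'r^'r) * (norm M ^ n /\<^sub>R fact n)"
  for M :: "complex^'r^'r"
  using norm_matpow_le[of M n] by (simp add: divide_simps mult.commute)

lemma matexp_summable: "summable (\<lambda>n. (1 / fact n) *\<^sub>R matpow M n)"
  by (rule summable_comparison_test'[OF _ matexp_norm_term_le])
    (intro summable_mult summable_exp_generic)

lemma norm_matexp_le: "norm (matexp M) \<le> norm (mat 1 :: complex^'r^'r) * exp (norm M)"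
  for M :: "complex^'r^'r"
proof -
  have "norm (matexp M) \<le> (\<Sum>n. norm (mat 1 :: complex^'r^'r) * (norm M ^ n /\<^sub>R fact n))"
    unfolding matexp_def
    by (rule norm_suminf_le[OF matexp_norm_term_le]) (intro summable_mult summable_exp_generic)
  also have "\<dots> = norm (mat 1 :: complex^'r^'r) * exp (norm M)"
    unfolding exp_def by (rule suminf_mult) (rule summable_exp_generic)
  finally show ?thesis .
qed

lemma commute_matexp: "X ** M = M ** X \<Longrightarrow> X ** matexp M = matexp M ** X"
  unfolding matexp_def
  by (intro suminf_mult_commute matexp_summable commute_scaleR commute_matpow)

lemma commute_rpow: "X ** M = M ** X \<Longrightarrow> X ** rpow t M = rpow t M ** X"
  unfolding rpow_def by (intro commute_matexp commute_scaleR)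

lemma matexp_0 [simp]: "matexp 0 = (mat 1 :: complex^'r^'r)"
proof -
  have "matpow (0 :: complex^'r^'r) n = (if n = 0 then mat 1 else 0)" for n
    by (cases n) (auto simp: matmul.zero_right)
  then have "(\<lambda>n. (1 / fact n) *\<^sub>R matpow (0 :: complex^'r^'r) n) = (\<lambda>n. if n = 0 then mat 1 else 0)"
    by (simp add: fun_eq_iff del: matpow.simps)
  then show ?thesis
    using sums_single[of 0 "\<lambda>_. mat 1 :: complex^'r^'r"]
    by (simp add: matexp_def sums_iff)
qed

lemma rpow_1 [simp]: "rpow 1 M = mat 1"
  by (simp add: rpow_def)

lemma matpow_scaleR: "matpow (s *\<^sub>R M) n = s ^ n *\<^sub>R matpow M n"
  by (induction n) (simp_all add: matmul.scaleR_left matmul.scaleR_right mult.commute)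

lemma matpow_Suc_left: "matpow M (Suc n) = M ** matpow M n"
  by (simp add: commute_matpow)

lemma has_derivative_vecI:
  fixes f :: "'a::real_normed_vector \<Rightarrow> 'b::euclidean_space^'n"
  assumes "\<And>i. ((\<lambda>x. f x $ i) has_derivative (\<lambda>h. D h $ i)) (at x)"
  shows "(f has_derivative D) (at x)"
  by (subst has_derivative_componentwise_within)
    (auto simp: Basis_vec_def inner_axis intro!: has_derivative_inner_left assms)

lemma matexp_sums: "(\<lambda>n. (1 / fact n) *\<^sub>R matpow M n) sums matexp M"
  unfolding matexp_def by (rule summable_sums[OF matexp_summable])

lemma sums_matrix_nth: "f sums (S :: complex^'n^'m) \<Longrightarrow> (\<lambda>n. f n $ i $ j) sums (S $ i $ j)"
  by (intro bounded_linear.sums[OF bounded_linear_vec_nth])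

text \<open>Each entry of exp(s M) is an everywhere convergent power series in s. It is
  differentiated termwise in a complex variable, and the derivative is then restricted to the real
  axis.\<close>

lemma has_vector_derivative_matexp:
  "((\<lambda>s. matexp (s *\<^sub>R M)) has_vector_derivative M ** matexp (s *\<^sub>R M)) (at s)"
  unfolding has_vector_derivative_def
proof (intro has_derivative_vecI)
  fix i j
  define c where "c n = matpow M n $ i $ j / fact n" for n
  have c: "(\<lambda>n. c n * of_real s ^ n) sums (matexp (s *\<^sub>R M) $ i $ j)" for s
    using sums_matrix_nth[OF matexp_sums[of "s *\<^sub>R M"], of i j]
    by (simp add: c_def matpow_scaleR scaleR_matrix_nth mult_ac del: vector_scaleR_component)
  have summ: "summable (\<lambda>n. c n * y ^ n)" for y
  proof -
    have bound: "norm (c n * y ^ n) \<le> norm (mat 1 :: complex^'a^'a) * (norm (norm y *\<^sub>R M) ^ n /\<^sub>R fact n)" for n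
    proof -
      have "norm (matpow M n $ i $ j) \<le> norm (matpow M n)"
        by (meson component_le_norm_cart order_trans Finite_Cartesian_Product.norm_nth_le)
      also have "\<dots> \<le> norm (mat 1 :: complex^'a^'a) * norm M ^ n"
        by (rule norm_matpow_le)
      finally have "norm (matpow M n $ i $ j) * norm y ^ n \<le> norm (mat 1 :: complex^'a^'a) * norm M ^ n * norm y ^ n"
        by (rule mult_right_mono) auto
      then show ?thesis
        by (simp add: c_def norm_mult norm_divide norm_power divide_simps power_mult_distrib ac_simps)
    qed
    show ?thesis
      by (intro summable_comparison_test'[OF _ bound] summable_mult summable_exp_generic)
  qed
  have "diffs c n * of_real s ^ n = (M ** ((1 / fact n) *\<^sub>R matpow (s *\<^sub>R M) n)) $ i $ j" for n
  proof -
    have "diffs c n = (M ** matpow M n) $ i $ j / fact n"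
      by (simp add: diffs_def c_def matpow_Suc_left fact_Suc del: matpow.simps of_nat_Suc)
    then show ?thesis
      by (simp add: matpow_scaleR matmul.scaleR_right scaleR_matrix_nth
          del: matpow.simps vector_scaleR_component)
  qed
  then have "(\<lambda>n. diffs c n * of_real s ^ n) sums ((M ** matexp (s *\<^sub>R M)) $ i $ j)"
    using sums_matrix_nth[OF bounded_linear.sums[OF matmul.bounded_linear_right matexp_sums, of M "s *\<^sub>R M"], of i j]
    by simp
  then have "((\<lambda>x. \<Sum>n. c n * x ^ n) has_field_derivative (M ** matexp (s *\<^sub>R M)) $ i $ j) (at (of_real s))"
    using termdiffs_strong_converges_everywhere[OF summ, of "of_real s"] by (simp add: sums_iff)
  then have "((\<lambda>x. \<Sum>n. c n * of_real x ^ n) has_vector_derivative (M ** matexp (s *\<^sub>R M)) $ i $ j) (at s)"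
    by (rule has_vector_derivative_real_field)
  then show "((\<lambda>x. matexp (x *\<^sub>R M) $ i $ j) has_derivative
      (\<lambda>h. (h *\<^sub>R (M ** matexp (s *\<^sub>R M))) $ i $ j)) (at s)"
    using c by (simp add: sums_iff has_vector_derivative_def)
qed

section \<open>Real powers as solutions of a differential equation\<close>

lemma has_vector_derivative_rpow:
  assumes "t > 0"
  shows "((\<lambda>t. rpow t M) has_vector_derivative (1 / t) *\<^sub>R (M ** rpow t M)) (at t)"
proof -
  have "(ln has_vector_derivative 1 / t) (at t)"
    using assms by (intro has_real_derivative_iff_has_vector_derivative[THEN iffD1] derivative_eq_intros) auto
  from vector_diff_chain_at[OF this has_vector_derivative_matexp]
  show ?thesis
    by (simp add: o_def rpow_def)
qed

text \<open>If X solves the equation, then t^(-Q) X(t) has derivative zero, hence equals its value I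
  at t = 1. This characterization takes the place of a product rule for matrix exponentials.\<close>

lemma rpow_unique:
  assumes X: "\<And>t. t > 0 \<Longrightarrow> (X has_vector_derivative (1 / t) *\<^sub>R (Q ** X t)) (at t)"
    and X1: "X 1 = mat 1" and t: "t > 0"
  shows "X t = rpow t Q"
proof -
  define J where "J t = rpow t (- Q)" for t
  \<comment> \<open>Stated for every solution, because it is applied both to the given
    \<open>X\<close> and to \<open>rpow t Q\<close>: each is then the inverse of
    \<open>J t\<close>.\<close>
  have J: "J t ** X t = mat 1"
    if X: "\<And>t. t > 0 \<Longrightarrow> (X has_vector_derivative (1 / t) *\<^sub>R (Q ** X t)) (at t)"
      and X1: "X 1 = mat 1" and t: "t > 0" for X t
  proof -
    have "((\<lambda>s. J s ** X s) has_vector_derivative 0) (at s within {0<..})" if s: "s \<in> {0<..}" for s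
    proof -
      have "((\<lambda>s. J s ** X s) has_vector_derivative
          (J s ** (1 / s) *\<^sub>R (Q ** X s) + (1 / s) *\<^sub>R (- Q ** J s) ** X s)) (at s)"
        using s unfolding J_def
        by (intro matmul.has_vector_derivative X has_vector_derivative_rpow) auto
      moreover have "Q ** J s = J s ** Q"
        unfolding J_def by (intro commute_rpow) (simp add: matmul.minus_left matmul.minus_right)
      then have "J s ** (1 / s) *\<^sub>R (Q ** X s) + (1 / s) *\<^sub>R (- Q ** J s) ** X s = 0"
        by (simp add: matmul.scaleR_left matmul.scaleR_right matmul.minus_left matrix_mul_assoc)
      ultimately show ?thesis
        by (simp add: has_vector_derivative_at_within)
    qed
    with has_vector_derivative_zero_constant[of "{0<..}" "\<lambda>s. J s ** X s"]
    obtain c where "\<And>s. s \<in> {0<..} \<Longrightarrow> J s ** X s = c"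
      by auto
    from this[of t] this[of 1] t show ?thesis
      by (simp add: X1 J_def)
  qed
  have "matrix_inv (J t) = X t"
    by (intro matrix_inv_eqI J X X1 t)
  moreover have "matrix_inv (J t) = rpow t Q"
    by (intro matrix_inv_eqI J has_vector_derivative_rpow t) auto
  ultimately show ?thesis by simp
qed

lemma rpow_add_mat:
  assumes t: "t > 0"
  shows "rpow t (P + mat (of_nat n)) = t ^ n *\<^sub>R rpow t P"
proof (rule sym, rule rpow_unique[OF _ _ t])
  fix t :: real assume t: "t > 0"
  have "((\<lambda>t. t ^ n *\<^sub>R rpow t P) has_vector_derivative
      (t ^ n *\<^sub>R (1 / t) *\<^sub>R (P ** rpow t P) + (real n * t ^ (n - 1)) *\<^sub>R rpow t P)) (at t)"
    by (rule has_vector_derivative_scaleR) (auto intro!: has_vector_derivative_rpow t derivative_eq_intros)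
  also have "real n * t ^ (n - 1) = (1 / t) * t ^ n * real n"
    using t by (cases n) auto
  finally show "((\<lambda>t. t ^ n *\<^sub>R rpow t P) has_vector_derivative
      (1 / t) *\<^sub>R ((P + mat (of_nat n)) ** t ^ n *\<^sub>R rpow t P)) (at t)"
    by (simp add: matmul.add_left matmul.scaleR_right mat_of_nat_mult scaleR_add_right mult_ac)
qed simp

text \<open>The logarithm is nonnegative for t >= 1. The exponent \<open>norm P\<close> is crude,
  but exp(-t) absorbs it at infinity; towards 0 the same estimate would only give a blow-up, so that
  end needs the spectral argument of the next section.\<close>

lemma norm_rpow_le:
  fixes P :: "complex^'r^'r"
  assumes "t \<ge> 1"
  shows "norm (rpow t P) \<le> norm (mat 1 :: complex^'r^'r) * t powr norm P"
  using norm_matexp_le[of "ln t *\<^sub>R P"] assms by (simp add: rpow_def powr_def mult.commute)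

section \<open>Eigenvectors, positive stability and invertibility\<close>

lemma scaleR_matrix_vector_mult: "(c *\<^sub>R M) *v x = c *\<^sub>R (M *v x)" for M :: "complex^'n^'m"
  by (simp add: vec_eq_iff matrix_vector_mult_def scaleR_sum_right)

lemma bounded_linear_matrix_vector_mult_left: "bounded_linear (\<lambda>M. M *v x)" for x :: "complex^'n"
  by (intro linear_conv_bounded_linear[THEN iffD1] linearI)
    (simp_all add: matrix_vector_mult_add_rdistrib scaleR_matrix_vector_mult)

lemma matexp_eigenvector:
  assumes "P *v v = \<mu> *s v"
  shows "matexp P *v v = exp \<mu> *s v"
proof -
  have pow: "matpow P n *v v = \<mu> ^ n *s v" for n
    by (induction n) (auto simp: assms vector_scalar_commute matrix_vector_mul_assoc[symmetric] mult_ac)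
  have lin: "bounded_linear (\<lambda>M. (M *v v) $ i)" for i
    by (intro bounded_linear_compose[OF bounded_linear_vec_nth bounded_linear_matrix_vector_mult_left])
  have "(\<lambda>n. (((1 / fact n) *\<^sub>R matpow P n) *v v) $ i) sums ((matexp P *v v) $ i)" for i
    by (rule bounded_linear.sums[OF lin matexp_sums])
  moreover have "(((1 / fact n) *\<^sub>R matpow P n) *v v) $ i = (\<mu> ^ n /\<^sub>R fact n) * v $ i" for i n
    by (simp add: scaleR_matrix_vector_mult pow) (simp add: scaleR_conv_of_real divide_simps)
  moreover have "(\<lambda>n. (\<mu> ^ n /\<^sub>R fact n) * v $ i) sums (exp \<mu> * v $ i)" for i
    by (intro sums_mult2 exp_converges)
  ultimately have "(matexp P *v v) $ i = exp \<mu> * v $ i" for i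
    using sums_unique2 by (metis (no_types, lifting) sums_cong)
  then show ?thesis
    by (simp add: vec_eq_iff)
qed

lemma mat_vector_mult: "mat c *v v = c *s v" for v :: "complex^'n"
  by (simp add: vec_eq_iff matrix_vector_mult_def mat_def if_distrib[where f="\<lambda>x. x * _"] cong: if_cong)

lemma eigenvector_add_mat: "P *v v = \<mu> *s v \<Longrightarrow> (P + mat c) *v v = (\<mu> + c) *s v"
  for v :: "complex^'r"
  by (simp add: matrix_vector_mult_add_rdistrib mat_vector_mult vec.scale_left_distrib)

lemma rpow_eigenvector:
  assumes "P *v v = \<mu> *s v" "t > 0"
  shows "rpow t P *v v = (of_real t powr \<mu>) *s v"
proof -
  have "(ln t *\<^sub>R P) *v v = (of_real (ln t) * \<mu>) *s v"
    by (simp add: scaleR_matrix_vector_mult assms vec_eq_iff)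
      (simp add: scaleR_conv_of_real)
  from matexp_eigenvector[OF this] assms(2) show ?thesis
    by (simp add: rpow_def powr_def Ln_of_real mult.commute)
qed

lemma positive_stable_add_nat:
  assumes "positive_stable P"
  shows "positive_stable (P + mat (of_nat n))"
  unfolding positive_stable_def
proof safe
  fix \<mu> v assume v: "v \<noteq> 0" "(P + mat (of_nat n)) *v v = \<mu> *s v"
  then have "P *v v = (\<mu> - of_nat n) *s v"
    using eigenvector_add_mat[OF v(2), of "- of_nat n"] mat_add[of "of_nat n" "- of_nat n", where 'n='a]
    by (simp add: add.assoc)
  then have "0 < Re (\<mu> - of_nat n)"
    using assms v(1) unfolding positive_stable_def by blast
  then show "0 < Re \<mu>" by simp
qed

lemma invertible_iff_ker: "invertible M \<longleftrightarrow> (\<forall>x. M *v x = 0 \<longrightarrow> x = 0)" for M :: "complex^'r^'r"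
  by (simp add: invertible_left_inverse matrix_left_invertible_ker)

lemma positive_stable_invertible: "positive_stable P \<Longrightarrow> invertible P"
  unfolding invertible_iff_ker positive_stable_def
  by (metis less_irrefl vec.scale_zero_left zero_complex.simps(1))

lemma invertible_matpoch:
  assumes "positive_stable P"
  shows "invertible (matpoch P n)"
proof (induction n)
  case 0
  show ?case by (auto simp: invertible_def)
next
  case (Suc n)
  then show ?case
    by (simp add: invertible_mult positive_stable_add_nat[OF assms] positive_stable_invertible)
qed

section \<open>Decay of matrix powers\<close>

text \<open>A product of factors P - \<mu> I, applied to \<open>X\<close> from the head of the list
  onwards. A list keeps multiplicities, and the argument \<open>X\<close> lets an induction over the
  list replace \<open>X\<close> by (P - \<mu> I) X.\<close>

primrec eigenprod :: "complex^'r^'r \<Rightarrow> complex list \<Rightarrow> complex^'n^'r \<Rightarrow> complex^'n^'r" where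
  "eigenprod P [] X = X"
| "eigenprod P (\<mu> # \<mu>s) X = eigenprod P \<mu>s ((P - mat \<mu>) ** X)"

lemma eigenprod_append: "eigenprod P (\<mu>s @ \<nu>s) X = eigenprod P \<nu>s (eigenprod P \<mu>s X)"
  by (induction \<mu>s arbitrary: X) auto

lemma eigenprod_mult_right: "eigenprod P \<mu>s (X ** Z) = eigenprod P \<mu>s X ** Z"
  by (induction \<mu>s arbitrary: X) (auto simp: matrix_mul_assoc)

lemma eigenprod_commute:
  assumes "Q ** P = P ** Q"
  shows "eigenprod P \<mu>s (Q ** X) = Q ** eigenprod P \<mu>s X"
proof (induction \<mu>s arbitrary: X)
  case (Cons \<mu> \<mu>s)
  have "(P - mat \<mu>) ** (Q ** X) = Q ** ((P - mat \<mu>) ** X)"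
    by (simp add: matmul.diff_left matmul.diff_right matrix_mul_assoc assms mat_mult_commute)
  then show ?case by (simp add: Cons.IH)
qed simp

text \<open>The powers of exponent 0 to d are one more than the real dimension d of the matrix
  space. Such a relation does the work of the Cayley-Hamilton theorem, since the degree of the
  polynomial is irrelevant.\<close>

lemma matrix_powers_dependent:
  fixes P :: "complex^'r^'r"
  obtains c :: "nat \<Rightarrow> real" and d :: nat and i where "i \<le> d" "c i \<noteq> 0" "(\<Sum>k\<le>d. c k *\<^sub>R matpow P k) = 0"
proof -
  define d where "d = DIM(complex^'r^'r)"
  show thesis
  proof (cases "inj_on (matpow P) {..d}")
    case True
    then have "card (matpow P ` {..d}) = Suc d"
      by (simp add: card_image)
    then have "dependent (matpow P ` {..d})"
      by (intro dependent_biggerset) (simp_all add: d_def)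
    then obtain u where u: "(\<Sum>M\<in>matpow P ` {..d}. u M *\<^sub>R M) = 0" "\<exists>M\<in>matpow P ` {..d}. u M \<noteq> 0"
      by (auto simp: dependent_finite)
    then obtain i where "i \<le> d" "u (matpow P i) \<noteq> 0"
      by auto
    moreover have "(\<Sum>k\<le>d. u (matpow P k) *\<^sub>R matpow P k) = 0"
      using u(1) by (simp add: sum.reindex[OF True])
    ultimately show thesis
      using that[of i d "\<lambda>k. u (matpow P k)"] by blast
  next
    case False
    then obtain i j where ij: "i \<le> d" "j \<le> d" "i \<noteq> j" "matpow P i = matpow P j"
      by (auto simp: inj_on_def)
    \<comment> \<open>Coinciding powers collapse in the image set, so linear dependence of that set
      says nothing; their difference is the relation instead.\<close>
    define c where "c k = (if k = i then 1 else if k = j then - 1 else 0 :: real)" for k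
    have "(\<Sum>k\<le>d. c k *\<^sub>R matpow P k) = (\<Sum>k\<le>d. (if k = i then matpow P i else 0) - (if k = j then matpow P j else 0))"
      using ij by (intro sum.cong) (auto simp: c_def)
    also have "\<dots> = 0"
      using ij by (simp add: sum_subtractf)
    finally show thesis
      using that[of i d c] ij by (simp add: c_def)
  qed
qed

text \<open>Horner's scheme; \<open>poly\<close> evaluates only at points of the coefficient
  ring.\<close>

definition matpoly :: "complex^'r^'r \<Rightarrow> complex poly \<Rightarrow> complex^'r^'r" where
  "matpoly P p = fold_coeffs (\<lambda>a Y. mat a + P ** Y) p 0"

lemma matpoly_0 [simp]: "matpoly P 0 = 0"
  by (simp add: matpoly_def)

lemma matpoly_pCons [simp]: "matpoly P (pCons a p) = mat a + P ** matpoly P p"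
  by (cases "p = 0 \<and> a = 0") (auto simp: matpoly_def matmul.zero_right)

lemma matpoly_add: "matpoly P (p + q) = matpoly P p + matpoly P q"
  by (induction p q rule: poly_induct2) (simp_all add: mat_add matmul.add_right)

lemma mat_mult_left_commute: "M ** (mat c ** N) = mat c ** (M ** N)"
  for M :: "complex^'n^'m" and N :: "complex^'p^'n"
  by (simp only: matrix_mul_assoc mat_mult_commute)

lemma matpoly_smult: "matpoly P (smult c p) = mat c ** matpoly P p"
  by (induction p)
    (simp_all add: matmul.zero_right matmul.add_right mat_mult_mat mat_mult_left_commute)

lemma matpoly_monom: "matpoly P (monom c n) = mat c ** matpow P n"
proof (induction n)
  case (Suc n)
  have "matpoly P (monom c (Suc n)) = P ** (mat c ** matpow P n)"
    by (simp add: monom_Suc Suc)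
  also have "\<dots> = mat c ** (P ** matpow P n)"
    by (rule mat_mult_left_commute)
  finally show ?case
    by (simp only: matpow_Suc_left)
qed (simp add: monom_0 matmul.zero_right)

lemma matpoly_sum: "matpoly P (sum f A) = (\<Sum>a\<in>A. matpoly P (f a))"
  by (induction A rule: infinite_finite_induct) (simp_all add: matpoly_add)

lemma matpoly_linear_factor: "matpoly P ([:- \<mu>, 1:] * q) = (P - mat \<mu>) ** matpoly P q"
proof -
  have "[:- \<mu>, 1:] * q = pCons 0 q + smult (- \<mu>) q" by simp
  then have "matpoly P ([:- \<mu>, 1:] * q) = P ** matpoly P q + mat (- \<mu>) ** matpoly P q"
    by (simp only: matpoly_add matpoly_smult matpoly_pCons mat_0 add_0)
  moreover have "mat (- \<mu>) = - (mat \<mu> :: complex^'a^'a)"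
    by (simp add: vec_eq_iff mat_def)
  ultimately show ?thesis
    by (simp add: matmul.diff_left matmul.minus_left)
qed

text \<open>Induction on the degree, with one root split off at a time by the fundamental theorem of
  algebra.\<close>

lemma matpoly_eigenprod:
  assumes "p \<noteq> 0"
  shows "\<exists>\<mu>s c. c \<noteq> 0 \<and> matpoly P p = mat c ** eigenprod P \<mu>s (mat 1)"
  using assms
proof (induction "degree p" arbitrary: p)
  case 0
  then obtain c where "p = [:c:]" by (metis degree_eq_zeroE)
  with 0 show ?case
    by (intro exI[of _ "[]"] exI[of _ c]) (simp add: matmul.zero_right)
next
  case (Suc n)
  then obtain \<mu> where "poly p \<mu> = 0"
    using fundamental_theorem_of_algebra[of p] by (auto simp: constant_degree)
  then obtain q where q: "p = [:- \<mu>, 1:] * q"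
    by (auto simp: poly_eq_0_iff_dvd dvd_def)
  with Suc.prems have "q \<noteq> 0" by auto
  then have "degree p = Suc (degree q)"
    unfolding q by (subst degree_mult_eq) auto
  with Suc.hyps(1)[of q] Suc.hyps(2) \<open>q \<noteq> 0\<close>
  obtain \<mu>s c where c: "c \<noteq> 0" "matpoly P q = mat c ** eigenprod P \<mu>s (mat 1)"
    by auto
  have "matpoly P p = (P - mat \<mu>) ** (mat c ** eigenprod P \<mu>s (mat 1))"
    unfolding q matpoly_linear_factor c ..
  also have "\<dots> = mat c ** ((P - mat \<mu>) ** eigenprod P \<mu>s (mat 1))"
    by (rule mat_mult_left_commute)
  \<comment> \<open>The new factor stands leftmost, so it is applied last and goes to the end of the
    list.\<close>
  finally show ?case
    using c(1) by (intro exI[of _ "\<mu>s @ [\<mu>]"] exI[of _ c]) (simp add: eigenprod_append)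
qed

lemma mat_mult_eq_0_iff: "mat c ** M = 0 \<longleftrightarrow> c = 0 \<or> M = 0" for M :: "complex^'n^'m"
  by (auto simp: vec_eq_iff mat_mult_nth)

lemma eigenprod_annihilates:
  fixes P :: "complex^'r^'r"
  obtains \<mu>s where "eigenprod P \<mu>s (mat 1) = (0 :: complex^'r^'r)"
proof -
  obtain c d i where c: "i \<le> d" "c i \<noteq> 0" "(\<Sum>k\<le>d. c k *\<^sub>R matpow P k) = 0"
    by (rule matrix_powers_dependent)
  define p where "p = (\<Sum>k\<le>d. monom (of_real (c k) :: complex) k)"
  have "coeff p i = of_real (c i)"
    using c(1) by (simp add: p_def coeff_sum)
  with c(2) have "p \<noteq> 0" by auto
  moreover have "matpoly P p = 0"
    using c(3) by (simp add: p_def matpoly_sum matpoly_monom mat_of_real_mult)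
  ultimately show thesis
    using matpoly_eigenprod[of p P] that by (auto simp: mat_mult_eq_0_iff)
qed

text \<open>An arbitrary annihilating polynomial may have roots that are not eigenvalues, and
  nothing is known about their real parts. The corresponding factors are invertible and commute with
  the others, so they cancel.\<close>

lemma eigenprod_drop_noneigenvalues:
  fixes P :: "complex^'r^'r"
  assumes "eigenprod P \<mu>s X = 0"
  shows "\<exists>\<nu>s. (\<forall>\<mu>\<in>set \<nu>s. \<not> invertible (P - mat \<mu>)) \<and> eigenprod P \<nu>s X = 0"
  using assms
proof (induction \<mu>s arbitrary: X)
  case (Cons \<mu> \<mu>s)
  then obtain \<nu>s where \<nu>s: "\<forall>\<mu>\<in>set \<nu>s. \<not> invertible (P - mat \<mu>)" "eigenprod P \<nu>s ((P - mat \<mu>) ** X) = 0"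
    by auto
  show ?case
  proof (cases "invertible (P - mat \<mu>)")
    case True
    have "(P - mat \<mu>) ** eigenprod P \<nu>s X = 0"
      using \<nu>s(2)
      by (subst (asm) eigenprod_commute) (simp_all add: matmul.diff_left matmul.diff_right mat_mult_commute)
    then have "matrix_inv (P - mat \<mu>) ** ((P - mat \<mu>) ** eigenprod P \<nu>s X) = 0"
      by (simp add: matmul.zero_right)
    then have "eigenprod P \<nu>s X = 0"
      by (simp add: matrix_mul_assoc matrix_inv_left True)
    with \<nu>s show ?thesis by auto
  next
    case False
    with \<nu>s show ?thesis by (intro exI[of _ "\<mu> # \<nu>s"]) auto
  qed
qed (auto intro: exI[of _ "[]"])

text \<open>A singular factor P - \<mu> I has an eigenvector in its kernel, which is where positive
  stability applies. Killing the identity suffices, because multiplication on the right passes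
  through \<open>eigenprod\<close>.\<close>

lemma positive_stable_eigenprod:
  fixes P :: "complex^'r^'r"
  assumes "positive_stable P"
  obtains \<mu>s where "\<And>\<mu>. \<mu> \<in> set \<mu>s \<Longrightarrow> 0 < Re \<mu>" "\<And>X :: complex^'n^'r. eigenprod P \<mu>s X = 0"
proof -
  obtain \<nu>s where \<nu>s: "\<forall>\<mu>\<in>set \<nu>s. \<not> invertible (P - mat \<mu>)" "eigenprod P \<nu>s (mat 1 :: complex^'r^'r) = 0"
    using eigenprod_annihilates eigenprod_drop_noneigenvalues by metis
  have "0 < Re \<mu>" if "\<mu> \<in> set \<nu>s" for \<mu>
  proof -
    from \<nu>s(1) that obtain v where v: "v \<noteq> 0" "(P - mat \<mu>) *v v = 0"
      unfolding invertible_iff_ker by blast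
    then have "P *v v = \<mu> *s v"
      by (simp add: matrix_vector_mult_diff_rdistrib mat_vector_mult)
    with v(1) assms show ?thesis unfolding positive_stable_def by blast
  qed
  moreover have "eigenprod P \<nu>s X = 0" for X :: "complex^'n^'r"
    using eigenprod_mult_right[of P \<nu>s "mat 1" X] \<nu>s(2) by (simp add: matmul.zero_left)
  ultimately show thesis by (rule that)
qed

text \<open>Apply the factors one after another: the last nonzero matrix before the product vanishes
  is the witness, and its nonzero columns are eigenvectors. \<open>G\<close> keeps annihilating each
  stage because it commutes with \<open>P\<close>.\<close>

lemma eigenprod_kernel_eigenvector:
  fixes X :: "complex^'n^'r"
  assumes "eigenprod P \<mu>s X = 0" "X \<noteq> 0" "G ** X = 0" "G ** P = P ** G"
  shows "\<exists>\<mu>\<in>set \<mu>s. \<exists>U :: complex^'n^'r. U \<noteq> 0 \<and> (P - mat \<mu>) ** U = 0 \<and> G ** U = 0"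
  using assms(1-3)
proof (induction \<mu>s arbitrary: X)
  case (Cons \<mu> \<mu>s)
  show ?case
  proof (cases "(P - mat \<mu>) ** X = 0")
    case True
    with Cons.prems show ?thesis by auto
  next
    case False
    have "G ** ((P - mat \<mu>) ** X) = (P - mat \<mu>) ** (G ** X)"
      by (simp add: matrix_mul_assoc matmul.diff_left matmul.diff_right assms(4) mat_mult_commute)
    with Cons.IH[of "(P - mat \<mu>) ** X"] Cons.prems False show ?thesis
      by (auto simp: matmul.zero_right)
  qed
qed simp

section \<open>Exponential decay from the factored annihilator\<close>

lemma bounded_linear_mat: "bounded_linear (mat :: complex \<Rightarrow> complex^'n^'n)"
  by (intro linear_conv_bounded_linear[THEN iffD1] linearI)
    (simp_all add: mat_add vec_eq_iff mat_def)

lemma norm_mat_mult: "norm (mat c ** M) = norm c * norm M" for M :: "complex^'n^'m"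
  using norm_cscale[of c M] by (simp add: cscale_eq_mat_mult)

text \<open>Induction over the list: \<open>(P - \<mu> I) x\<close> solves the same equation, is killed by the remaining
  factors, and is the inhomogeneity of the scalar equation satisfied by \<open>x\<close>.\<close>

lemma linear_ode_decay:
  fixes x :: "real \<Rightarrow> complex^'n^'r"
  assumes "\<And>\<mu>. \<mu> \<in> set \<mu>s \<Longrightarrow> \<epsilon> < Re \<mu>"
    and "\<And>s. (x has_vector_derivative - (P ** x s)) (at s)"
    and "\<And>s. eigenprod P \<mu>s (x s) = 0"
  shows "\<exists>C. \<forall>s\<ge>0. norm (x s) \<le> C * exp (- \<epsilon> * s)"
  using assms
proof (induction \<mu>s arbitrary: x)
  case Nil
  then show ?case by (intro exI[of _ 0]) simp
next
  case (Cons \<mu> \<mu>s)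
  define y where "y s = (P - mat \<mu>) ** x s" for s
  \<comment> \<open>The strict gap between \<epsilon> and Re \<mu> absorbs the polynomial factors
    that repeated eigenvalues would otherwise cause, so the rate \<epsilon> survives every induction
    step.\<close>
  define \<delta> where "\<delta> = Re \<mu> - \<epsilon>"
  have \<delta>: "\<delta> > 0" using Cons.prems(1) by (simp add: \<delta>_def)
  have "(y has_vector_derivative - (P ** y s)) (at s)" for s
  proof -
    have "(y has_vector_derivative (P - mat \<mu>) ** (- (P ** x s))) (at s)"
      unfolding y_def by (rule bounded_linear.has_vector_derivative[OF matmul.bounded_linear_right Cons.prems(2)])
    moreover have "(P - mat \<mu>) ** (- (P ** x s)) = - (P ** y s)"
      by (simp add: y_def matmul.minus_right matmul.diff_left matmul.diff_right matrix_mul_assoc mat_mult_commute)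
    ultimately show ?thesis by simp
  qed
  moreover have "eigenprod P \<mu>s (y s) = 0" for s
    using Cons.prems(3)[of s] by (simp add: y_def)
  ultimately have "\<exists>C. \<forall>s\<ge>0. norm (y s) \<le> C * exp (- \<epsilon> * s)"
    using Cons.prems(1) by (intro Cons.IH) simp_all
  then obtain C where C: "\<And>s. s \<ge> 0 \<Longrightarrow> norm (y s) \<le> C * exp (- \<epsilon> * s)"
    by blast
  have C0: "C \<ge> 0" using order_trans[OF norm_ge_zero C[of 0]] by simp
  \<comment> \<open>Integrating factor: the derivative of \<open>u\<close> is -exp(\<mu> s) y(s),
    and \<open>y\<close> is already bounded by the induction hypothesis.\<close>
  define u where "u s = mat (exp (\<mu> * of_real s)) ** x s" for s
  have u: "(u has_vector_derivative - (mat (exp (\<mu> * of_real s)) ** y s)) (at s)" for s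
  proof -
    have "((\<lambda>s. exp (\<mu> * of_real s)) has_vector_derivative \<mu> * exp (\<mu> * of_real s)) (at s)"
      by (rule has_vector_derivative_real_field[of "\<lambda>s. exp (\<mu> * s)"]) (auto intro!: derivative_eq_intros)
    from bounded_linear.has_vector_derivative[OF bounded_linear_mat this]
    have "((\<lambda>s. mat (exp (\<mu> * of_real s)) :: complex^'r^'r) has_vector_derivative
        mat (\<mu> * exp (\<mu> * of_real s))) (at s)" .
    from matmul.has_vector_derivative[OF this Cons.prems(2)]
    have "(u has_vector_derivative mat (exp (\<mu> * of_real s)) ** (- (P ** x s)) +
        mat (\<mu> * exp (\<mu> * of_real s)) ** x s) (at s)"
      unfolding u_def .
    moreover have "mat (\<mu> * exp (\<mu> * of_real s)) ** x s = mat (exp (\<mu> * of_real s)) ** (mat \<mu> ** x s)"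
      by (simp add: matrix_mul_assoc mat_mult_mat mult.commute)
    ultimately show ?thesis
      by (simp add: y_def matmul.minus_right matmul.diff_left matmul.diff_right)
  qed
  have "norm (x s) \<le> (norm (x 0) + C / \<delta>) * exp (- \<epsilon> * s)" if "s \<ge> 0" for s
  proof (cases "s = 0")
    case False
    with that have s: "s > 0" by simp
    \<comment> \<open>The derivative of \<open>u\<close> is bounded by C exp(\<delta> s), whose
      primitive appears on the right.\<close>
    have "norm (u s - u 0) \<le> C / \<delta> * exp (\<delta> * s) - C / \<delta> * exp (\<delta> * 0)"
    proof (rule differentiable_bound_general[OF s])
      show "continuous_on {0..s} u"
        using u by (meson continuous_at_imp_continuous_on has_vector_derivative_continuous)
      show "((\<lambda>s. C / \<delta> * exp (\<delta> * s)) has_vector_derivative C * exp (\<delta> * t)) (at t)" for t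
        using \<delta> by (intro has_real_derivative_iff_has_vector_derivative[THEN iffD1]) (auto intro!: derivative_eq_intros)
      show "norm (- (mat (exp (\<mu> * of_real t)) ** y t)) \<le> C * exp (\<delta> * t)" if "0 < t" for t
      proof -
        have "norm (- (mat (exp (\<mu> * of_real t)) ** y t)) = exp (Re \<mu> * t) * norm (y t)"
          by (simp add: norm_mat_mult)
        also have "\<dots> \<le> exp (Re \<mu> * t) * (C * exp (- \<epsilon> * t))"
          using C[of t] that by (intro mult_left_mono) auto
        also have "\<dots> = C * exp (\<delta> * t)"
          by (simp add: \<delta>_def algebra_simps exp_diff exp_minus field_simps)
        finally show ?thesis .
      qed
    qed (use u \<delta> in \<open>auto intro!: continuous_intros\<close>)
    have "norm (u s) \<le> norm (x 0) + C / \<delta> * exp (\<delta> * s)"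
    proof -
      have "u 0 = x 0" "0 \<le> C / \<delta>" using C0 \<delta> by (simp_all add: u_def)
      then show ?thesis
        using norm_triangle_sub[of "u s" "u 0"] \<open>norm (u s - u 0) \<le> _\<close> by simp
    qed
    moreover have "norm (u s) = exp (Re \<mu> * s) * norm (x s)"
      by (simp add: u_def norm_mat_mult)
    ultimately have "norm (x s) \<le> exp (- Re \<mu> * s) * (norm (x 0) + C / \<delta> * exp (\<delta> * s))"
      by (simp add: exp_minus field_simps)
    also have "\<dots> = norm (x 0) * exp (- Re \<mu> * s) + C / \<delta> * exp (- \<epsilon> * s)"
      by (simp add: \<delta>_def algebra_simps mult_exp_exp)
    also have "\<dots> \<le> norm (x 0) * exp (- \<epsilon> * s) + C / \<delta> * exp (- \<epsilon> * s)"
      using \<delta> s by (intro add_right_mono mult_left_mono) (auto simp: \<delta>_def)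
    finally show ?thesis by (simp add: algebra_simps)
  qed (use C0 \<delta> in simp)
  then show ?case by blast
qed

text \<open>With t = exp(-s), the power t^P becomes exp(-s P), a solution of x' = -P x, and decay as
  s tends to infinity becomes a positive power of t near 0.\<close>

lemma rpow_decay:
  fixes P :: "complex^'r^'r"
  assumes "positive_stable P"
  obtains \<epsilon> C where "\<epsilon> > 0" "\<And>t. 0 < t \<Longrightarrow> t \<le> 1 \<Longrightarrow> norm (rpow t P) \<le> C * t powr \<epsilon>"
proof -
  obtain \<mu>s where \<mu>s: "\<And>\<mu>. \<mu> \<in> set \<mu>s \<Longrightarrow> 0 < Re \<mu>" "\<And>X :: complex^'r^'r. eigenprod P \<mu>s X = 0"
    using positive_stable_eigenprod[OF assms] by metis
  \<comment> \<open>The list is finite, so there is room between 0 and its real parts; halving keeps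
    the inequality strict.\<close>
  have "\<exists>\<epsilon>>0. \<forall>\<mu>\<in>set \<mu>s. \<epsilon> < Re \<mu>"
    using \<mu>s(1)
  proof (induction \<mu>s)
    case (Cons \<mu> \<mu>s)
    then obtain \<epsilon> where "\<epsilon> > 0" "\<forall>\<mu>\<in>set \<mu>s. \<epsilon> < Re \<mu>" by auto
    with Cons.prems show ?case
      by (intro exI[of _ "min \<epsilon> (Re \<mu> / 2)"]) force
  qed (auto intro: exI[of _ 1])
  then obtain \<epsilon> where \<epsilon>: "\<epsilon> > 0" "\<And>\<mu>. \<mu> \<in> set \<mu>s \<Longrightarrow> \<epsilon> < Re \<mu>" by auto
  have "\<exists>C. \<forall>s\<ge>0. norm (matexp (s *\<^sub>R (- P))) \<le> C * exp (- \<epsilon> * s)"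
    using has_vector_derivative_matexp[of "- P"]
    by (intro linear_ode_decay[OF \<epsilon>(2), where P=P]) (auto simp: \<mu>s(2) matmul.minus_left)
  then obtain C where C: "\<And>s. s \<ge> 0 \<Longrightarrow> norm (matexp (s *\<^sub>R (- P))) \<le> C * exp (- \<epsilon> * s)"
    by auto
  have "norm (rpow t P) \<le> C * t powr \<epsilon>" if "0 < t" "t \<le> 1" for t
    using C[of "- ln t"] that by (simp add: rpow_def powr_def mult.commute)
  with \<epsilon>(1) show thesis by (rule that)
qed

section \<open>The extended beta function\<close>

text \<open>The gauge integral of \<open>f\<close> may converge only conditionally, so t^k f cannot
  be dominated by the absolute value of \<open>f\<close>. Monotonicity of t^k and the second mean
  value theorem reduce each moment to integrals of \<open>f\<close> over subintervals.\<close>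

lemma integrable_real_power_mult_bounded:
  fixes f :: "real \<Rightarrow> real"
  assumes "f integrable_on {0..1}"
  obtains K where "\<And>k. \<bar>integral {0..1} (\<lambda>t. t ^ k * f t)\<bar> \<le> K"
proof -
  have "compact ((\<lambda>x. integral {0..x} f) ` {0..1})"
    by (rule compact_continuous_image[OF indefinite_integral_continuous_1[OF assms]]) auto
  then have "\<exists>K. \<forall>x\<in>{0..1}. \<bar>integral {0..x} f\<bar> \<le> K"
    by (auto dest!: compact_imp_bounded simp: bounded_iff)
  then obtain K where K: "\<And>x. x \<in> {0..1} \<Longrightarrow> \<bar>integral {0..x} f\<bar> \<le> K"
    by blast
  have K': "\<bar>integral {c..1} f\<bar> \<le> 2 * K" if "c \<in> {0..1}" for c
    using Henstock_Kurzweil_Integration.integral_combine[of 0 c 1 f] K[OF that] K[of 1] that assms by auto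
  have "\<bar>integral {0..1} (\<lambda>t. t ^ k * f t)\<bar> \<le> 3 * K" for k
  proof -
    have "f integrable_on {0..1}" "(0::real) \<le> 1"
      by (auto simp: assms)
    from second_mean_value_theorem_full[OF this, of "\<lambda>t. t ^ k"]
    obtain c where c: "c \<in> {0..1}"
      "((\<lambda>x. x ^ k * f x) has_integral (0 ^ k * integral {0..c} f + 1 ^ k * integral {c..1} f)) {0..1}"
      by (auto intro: power_mono)
    \<comment> \<open>For k = 0 the factor \<open>0 ^ k\<close> is 1 and both pieces count, giving K
      + 2 K.\<close>
    moreover have "\<bar>0 ^ k * integral {0..c} f + 1 ^ k * integral {c..1} f\<bar> \<le> 3 * K"
      using K[OF c(1)] K'[OF c(1)] by (cases k) auto
    ultimately show ?thesis
      by (simp add: integral_unique)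
  qed
  then show thesis by (rule that)
qed

lemma scalar_moments_bounded:
  fixes f :: "real \<Rightarrow> real"
  obtains K where "\<And>k. \<bar>integral {0<..<1} (\<lambda>t. t ^ k * f t)\<bar> \<le> K"
proof (cases "\<exists>k. (\<lambda>t. t ^ k * f t) integrable_on {0..1}")
  case False
  then have "\<not> (\<lambda>t. t ^ k * f t) integrable_on {0<..<1}" for k
    by (simp add: integrable_on_open_interval_real)
  then show thesis
    by (intro that[of 0]) (simp add: not_integrable_integral)
next
  case True
  \<comment> \<open>The first integrable moment serves as the new base function. Those below it have
    the default value 0 by minimality, the others are moments of t^N f.\<close>
  define N where "N = (LEAST k. (\<lambda>t. t ^ k * f t) integrable_on {0..1})"
  have "(\<lambda>t. t ^ N * f t) integrable_on {0..1}"
    unfolding N_def using True by (rule LeastI_ex)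
  then obtain K where K: "\<And>k. \<bar>integral {0..1} (\<lambda>t. t ^ k * (t ^ N * f t))\<bar> \<le> K"
    using integrable_real_power_mult_bounded[of "\<lambda>t. t ^ N * f t"] by blast
  have "\<bar>integral {0<..<1} (\<lambda>t. t ^ k * f t)\<bar> \<le> K" for k
  proof (cases "N \<le> k")
    case True
    then show ?thesis
      using K[of "k - N"]
      by (simp add: integral_open_interval_real mult.assoc[symmetric] power_add[symmetric])
  next
    case False
    then have "\<not> (\<lambda>t. t ^ k * f t) integrable_on {0..1}"
      using not_less_Least[of k "\<lambda>k. (\<lambda>t. t ^ k * f t) integrable_on {0..1}"] by (simp add: N_def)
    then show ?thesis
      using order_trans[OF abs_ge_zero K[of 0]]
      by (simp add: not_integrable_integral integral_open_interval_real[symmetric])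
  qed
  then show thesis by (rule that)
qed

text \<open>No integrability is assumed: a non-integrable function has integral 0, and once some moment
  exists, the later ones are bounded by the second mean value theorem.\<close>

lemma moments_bounded:
  fixes f :: "real \<Rightarrow> 'a::euclidean_space"
  obtains K where "\<And>k. norm (integral {0<..<1} (\<lambda>t. t ^ k *\<^sub>R f t)) \<le> K"
proof -
  have "\<forall>b. \<exists>K. \<forall>k. \<bar>integral {0<..<1} (\<lambda>t. t ^ k * (f t \<bullet> b))\<bar> \<le> K"
    by (metis scalar_moments_bounded)
  then obtain K where K: "\<And>b k. \<bar>integral {0<..<1} (\<lambda>t. t ^ k * (f t \<bullet> b))\<bar> \<le> K b"
    by metis
  have "norm (integral {0<..<1} (\<lambda>t. t ^ k *\<^sub>R f t)) \<le> (\<Sum>b\<in>Basis. K b)" for k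
  proof (cases "(\<lambda>t. t ^ k *\<^sub>R f t) integrable_on {0<..<1}")
    case True
    have "norm (integral {0<..<1} (\<lambda>t. t ^ k *\<^sub>R f t))
        \<le> (\<Sum>b\<in>Basis. \<bar>integral {0<..<1} (\<lambda>t. t ^ k *\<^sub>R f t) \<bullet> b\<bar>)"
      by (rule norm_le_l1)
    also have "\<dots> = (\<Sum>b\<in>Basis. \<bar>integral {0<..<1} (\<lambda>t. t ^ k * (f t \<bullet> b))\<bar>)"
      using integral_component_eq[OF True] by (simp add: inner_scaleR_left)
    also have "\<dots> \<le> (\<Sum>b\<in>Basis. K b)"
      by (intro sum_mono K)
    finally show ?thesis .
  next
    \<comment> \<open>A single bad component makes the whole integral 0, although other components
      may well have nonzero integrals.\<close>
    case False
    then show ?thesis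
      using order_trans[OF abs_ge_zero K] by (simp add: not_integrable_integral sum_nonneg)
  qed
  then show thesis by (rule that)
qed

text \<open>Without integrability the integral is 0, which commutes with everything.\<close>

lemma commute_integral:
  fixes X :: "complex^'r^'r"
  assumes "\<And>t. t \<in> S \<Longrightarrow> X ** f t = f t ** X"
  shows "X ** integral S f = integral S f ** X"
proof (cases "f integrable_on S")
  case True
  have "X ** integral S f = integral S (\<lambda>t. X ** f t)"
    using integral_linear[OF True matmul.bounded_linear_right, of X] by (simp add: o_def)
  also have "\<dots> = integral S (\<lambda>t. f t ** X)"
    by (intro integral_cong assms)
  also have "\<dots> = integral S f ** X"
    using integral_linear[OF True matmul.bounded_linear_left, of X] by (simp add: o_def)
  finally show ?thesis .
qed (simp add: not_integrable_integral matmul.zero_left matmul.zero_right)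

section \<open>Convergence of the confluent series, and commutation with the extended beta
  function\<close>

lemma norm_matpoch_Suc_le:
  "norm (matpoch M (Suc n)) \<le> norm (matpoch M n) * (norm M + real n)"
proof -
  have "matpoch M (Suc n) = matpoch M n ** M + real n *\<^sub>R matpoch M n"
    by (simp add: matmul.add_right mat_mult_commute mat_of_nat_mult)
  also have "norm \<dots> \<le> norm (matpoch M n) * norm M + real n * norm (matpoch M n)"
    by (intro norm_triangle_le add_mono norm_matrix_mult_le) auto
  finally show ?thesis by (simp add: algebra_simps)
qed

text \<open>From \<open>n X = I - X B\<close> for \<open>X = (B + n I)\<^sup>-\<^sup>1\<close>.\<close>

lemma norm_matrix_inv_add_nat_le:
  fixes B :: "complex^'r^'r"
  assumes "invertible (B + mat (of_nat n))" "real n > norm B"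
  shows "norm (matrix_inv (B + mat (of_nat n))) \<le> norm (mat 1 :: complex^'r^'r) / (real n - norm B)"
proof -
  define X where "X = matrix_inv (B + mat (of_nat n))"
  have "X ** B + real n *\<^sub>R X = mat 1"
    using matrix_inv_left[OF assms(1)]
    by (simp add: X_def matmul.add_right mat_mult_commute mat_of_nat_mult)
  then have "real n *\<^sub>R X = mat 1 - X ** B"
    by (simp add: algebra_simps)
  then have "real n * norm X = norm (mat 1 - X ** B)"
    by (metis abs_of_nat norm_scaleR)
  also have "\<dots> \<le> norm (mat 1 :: complex^'r^'r) + norm X * norm B"
    by (intro norm_triangle_le_diff add_mono norm_matrix_mult_le order_refl)
  finally show ?thesis
    using assms(2) by (simp add: X_def[symmetric] field_simps)
qed

text \<open>Ratio test: in norm, (B + n I)^(-1) is of order 1/n and offsets the growth of A + n I,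
  so the 1/(n + 1) from the factorial sends the ratio to 0. Convergence is what allows a commuting
  matrix to pass through the sum.\<close>

lemma hyp1F1_summable:
  fixes A B W :: "complex^'r^'r"
  assumes "positive_stable B"
  shows "summable (\<lambda>n. (1 / fact n) *\<^sub>R (matpoch A n ** matrix_inv (matpoch B n) ** matpow W n))"
proof -
  define R where "R n = matrix_inv (B + mat (of_nat n))" for n
  define q where "q n = (norm A + real n) * norm (R n) * norm W / real (Suc n)" for n
  \<comment> \<open>The three norms are kept separate, since each of them has a controllable step
    from n to n + 1 and the norm of the product does not.\<close>
  define u where "u n = (1 / fact n) * (norm (matpoch A n) * norm (matrix_inv (matpoch B n)) * norm (matpow W n))" for n
  have u0: "u n \<ge> 0" for n by (simp add: u_def)
  have u_Suc: "u (Suc n) \<le> q n * u n" for n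
  proof -
    have "matrix_inv (matpoch B (Suc n)) = R n ** matrix_inv (matpoch B n)"
      by (simp add: R_def matrix_inv_mult invertible_matpoch positive_stable_invertible
          positive_stable_add_nat assms)
    then have "norm (matrix_inv (matpoch B (Suc n))) \<le> norm (R n) * norm (matrix_inv (matpoch B n))"
      by (simp add: norm_matrix_mult_le)
    moreover have "norm (matpow W (Suc n)) \<le> norm (matpow W n) * norm W"
      by (simp add: norm_matrix_mult_le)
    ultimately have "u (Suc n) \<le> (1 / fact (Suc n)) * ((norm (matpoch A n) * (norm A + real n)) *
        (norm (R n) * norm (matrix_inv (matpoch B n))) * (norm (matpow W n) * norm W))"
      unfolding u_def by (intro mult_left_mono mult_mono norm_matpoch_Suc_le) auto
    also have "\<dots> = q n * u n"
      by (simp add: q_def u_def divide_simps)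
    finally show ?thesis .
  qed
  have q_le: "q n \<le> (norm A + real n) * (norm (mat 1 :: complex^'r^'r) / (real n - norm B)) * norm W / real (Suc n)"
    if "real n > norm B" for n
    unfolding q_def R_def
    by (intro divide_right_mono mult_right_mono mult_left_mono norm_matrix_inv_add_nat_le that
        positive_stable_invertible positive_stable_add_nat assms) auto
  have "((\<lambda>n. (a + real n) * (e / (real n - b)) * w / real (Suc n)) \<longlongrightarrow> 0) sequentially" for a b e w :: real
    by real_asymp
  from order_tendstoD(2)[OF this, of "1/2" "norm A" "norm (mat 1 :: complex^'r^'r)" "norm B" "norm W"]
  have "eventually (\<lambda>n. (norm A + real n) * (norm (mat 1 :: complex^'r^'r) / (real n - norm B)) * norm W / real (Suc n) < 1 / 2) sequentially"
    by simp
  moreover have "eventually (\<lambda>n. real n > norm B) sequentially"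
    using eventually_gt_at_top[of "nat \<lceil>norm B\<rceil>"] by (eventually_elim) linarith
  ultimately have "eventually (\<lambda>n. q n \<le> 1 / 2) sequentially"
    by eventually_elim (use q_le order_trans less_imp_le in blast)
  then obtain N where N: "\<And>n. n \<ge> N \<Longrightarrow> q n \<le> 1 / 2"
    by (auto simp: eventually_sequentially)
  have "summable u"
  proof (rule summable_ratio_test[of "1 / 2" N])
    fix n assume "n \<ge> N"
    then have "q n * u n \<le> 1 / 2 * u n"
      by (intro mult_right_mono N u0)
    then show "norm (u (Suc n)) \<le> 1 / 2 * norm (u n)"
      using u_Suc[of n] u0[of n] u0[of "Suc n"] by simp
  qed simp
  moreover have "norm ((1 / fact n) *\<^sub>R (matpoch A n ** matrix_inv (matpoch B n) ** matpow W n)) \<le> u n" for n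
  proof -
    have "norm (matpoch A n ** matrix_inv (matpoch B n) ** matpow W n)
        \<le> norm (matpoch A n ** matrix_inv (matpoch B n)) * norm (matpow W n)"
      by (rule norm_matrix_mult_le)
    also have "\<dots> \<le> norm (matpoch A n) * norm (matrix_inv (matpoch B n)) * norm (matpow W n)"
      by (intro mult_right_mono norm_matrix_mult_le) auto
    finally show ?thesis by (simp add: u_def divide_right_mono)
  qed
  ultimately show ?thesis
    by (rule summable_comparison_test')
qed

lemma commute_hyp1F1:
  assumes "positive_stable B" "X ** A = A ** X" "X ** B = B ** X" "X ** W = W ** X"
  shows "X ** hyp1F1 A B W = hyp1F1 A B W ** X"
  unfolding hyp1F1_def
  by (intro suminf_mult_commute hyp1F1_summable commute_scaleR commute_mult commute_matpoch
      commute_matpow commute_matrix_inv invertible_matpoch assms)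

lemma commute_extBeta:
  assumes "positive_stable B" "X ** A = A ** X" "X ** B = B ** X" "X ** Y = Y ** X"
    "X ** P = P ** X" "X ** Q = Q ** X"
  shows "X ** extBeta A B Y P Q = extBeta A B Y P Q ** X"
proof -
  have *: "X ** (M - mat 1) = (M - mat 1) ** X" if "X ** M = M ** X" for M
    using that by (simp add: matmul.diff_left matmul.diff_right)
  show ?thesis
    unfolding extBeta_def
    by (intro commute_integral commute_mult commute_hyp1F1 commute_rpow * assms)
      (simp add: matmul.minus_left matmul.minus_right commute_scaleR assms)
qed

lemma extBeta_add_nat_bounded:
  obtains K where "\<And>k. norm (extBeta A B Y (P + mat (of_nat k)) Q) \<le> K"
proof -
  define f where "f t = hyp1F1 A B (- ((1 / (t * (1 - t))) *\<^sub>R Y)) ** rpow t (P - mat 1) ** rpow (1 - t) (Q - mat 1)" for t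
  have "extBeta A B Y (P + mat (of_nat k)) Q = integral {0<..<1} (\<lambda>t. t ^ k *\<^sub>R f t)" for k
    unfolding extBeta_def
  proof (rule integral_cong)
    fix t :: real assume "t \<in> {0<..<1}"
    then have "rpow t (P + mat (of_nat k) - mat 1) = t ^ k *\<^sub>R rpow t (P - mat 1)"
      using rpow_add_mat[of t "P - mat 1" k] by (simp add: algebra_simps)
    then show "hyp1F1 A B (- ((1 / (t * (1 - t))) *\<^sub>R Y)) ** rpow t (P + mat (of_nat k) - mat 1) **
        rpow (1 - t) (Q - mat 1) = t ^ k *\<^sub>R f t"
      by (simp add: f_def matmul.scaleR_left matmul.scaleR_right)
  qed
  with moments_bounded[of f] show thesis
    by (metis that)
qed

section \<open>The gamma matrix function\<close>

lemma continuous_rpow: "t > 0 \<Longrightarrow> isCont (\<lambda>t. rpow t M) t"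
  by (rule has_vector_derivative_continuous[OF has_vector_derivative_rpow])

lemma rpow_eq_scaleR: "t > 0 \<Longrightarrow> rpow t P = t *\<^sub>R rpow t (P - mat 1)"
  using rpow_add_mat[of t "P - mat 1" 1] by simp

lemma Gamma_integrand_integrable_real:
  fixes a :: real
  assumes "a > 0"
  shows "(\<lambda>t. exp (- t) * t powr (a - 1)) integrable_on {0<..}"
proof -
  have "(\<lambda>t. norm (complex_of_real t powr (of_real a - 1) / of_real (exp t))) integrable_on {0<..}"
    using absolutely_integrable_Gamma_integral'[of "of_real a"] assms
    by (intro absolutely_integrable_on_def[THEN iffD1, THEN conjunct2]) auto
  moreover have "norm (complex_of_real t powr (of_real a - 1) / of_real (exp t)) = exp (- t) * t powr (a - 1)"
    if "t \<in> {0<..}" for t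
    using that by (simp add: norm_divide norm_powr_real_powr exp_minus field_simps)
  ultimately show ?thesis
    by (rule integrable_eq)
qed

text \<open>The power bound near 0 and the crude bound at infinity both lead to scalar gamma
  integrands, and their sum dominates on the whole half-line.\<close>

lemma matGamma_integrable:
  fixes P :: "complex^'r^'r"
  assumes "positive_stable P"
  shows "set_integrable lborel {0<..} (\<lambda>t. exp (- t) *\<^sub>R rpow t (P - mat 1))"
proof -
  obtain \<epsilon> C where \<epsilon>: "\<epsilon> > 0" and C: "\<And>t. 0 < t \<Longrightarrow> t \<le> 1 \<Longrightarrow> norm (rpow t P) \<le> C * t powr \<epsilon>"
    using rpow_decay[OF assms] by metis
  \<comment> \<open>Chosen so that K - 1 is the growth exponent of t^(P-I) for t >= 1 and K is
    positive.\<close>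
  define K where "K = norm (P - mat 1) + 1"
  define D where "D = norm (mat 1 :: complex^'r^'r)"
  let ?g = "\<lambda>t. exp (- t) *\<^sub>R rpow t (P - mat 1)"
  have C0: "C \<ge> 0" using order_trans[OF norm_ge_zero C[of 1]] by simp
  have bound: "norm (?g t) \<le> C * (exp (- t) * t powr (\<epsilon> - 1)) + D * (exp (- t) * t powr (K - 1))"
    if "t > 0" for t
  proof (cases "t \<le> 1")
    case True
    have "t * norm (rpow t (P - mat 1)) \<le> C * t powr \<epsilon>"
      using C[OF that True] that by (simp add: rpow_eq_scaleR[OF that, of P])
    then have "norm (rpow t (P - mat 1)) \<le> C * t powr (\<epsilon> - 1)"
      using that by (simp add: powr_diff field_simps)
    from mult_left_mono[OF this, of "exp (- t)"]
    have "norm (?g t) \<le> C * (exp (- t) * t powr (\<epsilon> - 1))"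
      by (simp only: norm_scaleR abs_exp_cancel mult.left_commute[of _ C] exp_ge_zero)
    moreover have "D * (exp (- t) * t powr (K - 1)) \<ge> 0"
      by (simp add: D_def)
    ultimately show ?thesis by linarith
  next
    case False
    then have "norm (rpow t (P - mat 1)) \<le> D * t powr (K - 1)"
      using norm_rpow_le[of t "P - mat 1"] by (simp add: D_def K_def)
    from mult_left_mono[OF this, of "exp (- t)"]
    have "norm (?g t) \<le> D * (exp (- t) * t powr (K - 1))"
      by (simp only: norm_scaleR abs_exp_cancel mult.left_commute[of _ D] exp_ge_zero)
    moreover have "C * (exp (- t) * t powr (\<epsilon> - 1)) \<ge> 0"
      using C0 by simp
    ultimately show ?thesis by linarith
  qed
  have cont: "continuous_on {0<..} ?g"
    by (intro continuous_at_imp_continuous_on ballI continuous_intros continuous_rpow) auto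
  have "?g absolutely_integrable_on {0<..}"
  proof (rule measurable_bounded_by_integrable_imp_absolutely_integrable)
    show "?g \<in> borel_measurable (lebesgue_on {0<..})"
      by (intro continuous_imp_measurable_on_sets_lebesgue cont) auto
    show "(\<lambda>t. C * (exp (- t) * t powr (\<epsilon> - 1)) + D * (exp (- t) * t powr (K - 1))) integrable_on {0<..}"
      using \<epsilon> by (intro integrable_add integrable_on_mult_right Gamma_integrand_integrable_real)
        (auto simp: K_def add_nonneg_pos)
  qed (use bound in auto)
  \<comment> \<open>Borel measurability of the continuous integrand turns integrability for the
    completed measure into integrability for \<open>lborel\<close>, the form used by the fundamental
    theorem for interval integrals.\<close>
  moreover have "(\<lambda>t. indicator {0<..} t *\<^sub>R ?g t) \<in> borel_measurable lborel"
    using borel_measurable_continuous_on_indicator[OF _ cont] by simp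
  ultimately show ?thesis
    unfolding set_integrable_def by (simp add: integrable_completion)
qed

lemma matGamma_has_integral:
  assumes "positive_stable P"
  shows "((\<lambda>t. exp (- t) *\<^sub>R rpow t (P - mat 1)) has_integral matGamma P) {0<..}"
  unfolding matGamma_def
  using set_borel_integral_eq_integral(1)[OF matGamma_integrable[OF assms]]
  by (rule integrable_integral)

text \<open>Integration by parts, arranged as one integral: F(t) = exp(-t) t^P vanishes at both
  ends, and its derivative is the difference of the two integrands.\<close>

lemma matGamma_add_one:
  fixes P :: "complex^'r^'r"
  assumes P: "positive_stable P"
  shows "matGamma (P + mat 1) = P ** matGamma P"
proof -
  have P1: "positive_stable (P + mat 1)"
    using positive_stable_add_nat[OF P, of 1] by simp
  obtain \<epsilon> C where \<epsilon>: "\<epsilon> > 0" and C: "\<And>t. 0 < t \<Longrightarrow> t \<le> 1 \<Longrightarrow> norm (rpow t P) \<le> C * t powr \<epsilon>"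
    using rpow_decay[OF P] by metis
  define F where "F t = exp (- t) *\<^sub>R rpow t P" for t
  define f where "f t = P ** (exp (- t) *\<^sub>R rpow t (P - mat 1)) - exp (- t) *\<^sub>R rpow t (P + mat 1 - mat 1)" for t
  have f_int: "set_integrable lborel {0<..} f"
  proof -
    have "integrable lborel (\<lambda>t. P ** (indicator {0<..} t *\<^sub>R (exp (- t) *\<^sub>R rpow t (P - mat 1))))"
      using matGamma_integrable[OF P] unfolding set_integrable_def
      by (rule integrable_bounded_linear[OF matmul.bounded_linear_right])
    then have "set_integrable lborel {0<..} (\<lambda>t. P ** (exp (- t) *\<^sub>R rpow t (P - mat 1)))"
      unfolding set_integrable_def by (simp only: matmul.scaleR_right)
    then show ?thesis
      unfolding f_def by (intro set_integral_diff matGamma_integrable P1)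
  qed
  have "(LBINT t=0..\<infinity>. f t) = 0 - 0"
  proof (rule interval_integral_FTC_integrable[where F = F])
    show "(F has_vector_derivative f t) (at t)" if "0 < ereal t" for t
    proof -
      from that have t: "t > 0" by simp
      have "(F has_vector_derivative exp (- t) *\<^sub>R ((1 / t) *\<^sub>R (P ** rpow t P)) + (- exp (- t)) *\<^sub>R rpow t P) (at t)"
        unfolding F_def
        by (rule has_vector_derivative_scaleR)
          (auto intro!: derivative_eq_intros has_vector_derivative_rpow t)
      moreover have "(1 / t) *\<^sub>R (P ** rpow t P) = P ** rpow t (P - mat 1)"
        using t by (simp add: rpow_eq_scaleR[OF t, of P] matmul.scaleR_right)
      ultimately show ?thesis
        by (simp add: f_def matmul.scaleR_right)
    qed
    show "isCont f t" if "0 < ereal t" for t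
      using that unfolding f_def
      by (intro continuous_intros continuous_rpow matmul.isCont) auto
    show "set_integrable lborel (einterval 0 \<infinity>) f"
      using f_int by (simp add: einterval_def greaterThan_def zero_ereal_def)
    \<comment> \<open>The boundary term at 0 vanishes because the decay exponent of t^P is
      positive.\<close>
    show "((F \<circ> real_of_ereal) \<longlongrightarrow> 0) (at_right 0)"
      unfolding zero_ereal_def ereal_tendsto_simps
    proof (rule Lim_null_comparison)
      show "\<forall>\<^sub>F t in at_right 0. norm (F t) \<le> C * t powr \<epsilon>"
        using eventually_at_right_real[OF zero_less_one]
      proof eventually_elim
        case (elim t)
        then have "norm (F t) \<le> 1 * norm (rpow t P)"
          unfolding F_def norm_scaleR by (intro mult_right_mono) auto
        with C[of t] elim show ?case by simp
      qed
      show "((\<lambda>t. C * t powr \<epsilon>) \<longlongrightarrow> 0) (at_right 0)"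
        using \<epsilon> by real_asymp
    qed
    show "((F \<circ> real_of_ereal) \<longlongrightarrow> 0) (at_left \<infinity>)"
      unfolding ereal_tendsto_simps
    proof (rule Lim_null_comparison)
      show "\<forall>\<^sub>F t in at_top. norm (F t) \<le> exp (- t) * (norm (mat 1 :: complex^'r^'r) * t powr norm P)"
        using eventually_ge_at_top[of 1] by eventually_elim (simp add: F_def norm_rpow_le)
      show "((\<lambda>t. exp (- t) * (c * t powr b)) \<longlongrightarrow> 0) at_top" for b c :: real
        by real_asymp
    qed
  qed simp
  moreover have "(LBINT t=0..\<infinity>. f t) = integral {0<..} f"
    using interval_integral_eq_integral'[of 0 \<infinity> f] f_int
    by (simp add: einterval_def greaterThan_def zero_ereal_def)
  moreover have "(f has_integral (P ** matGamma P - matGamma (P + mat 1))) {0<..}"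
    unfolding f_def
    using has_integral_linear[OF matGamma_has_integral[OF P] matmul.bounded_linear_right, of P]
    by (intro has_integral_diff matGamma_has_integral P1) (simp add: o_def)
  ultimately show ?thesis
    by (simp add: integral_unique)
qed

lemma matGamma_add_nat:
  assumes "positive_stable P"
  shows "matGamma (P + mat (of_nat n)) = matpoch P n ** matGamma P"
proof (induction n)
  case (Suc n)
  have "matGamma (P + mat (of_nat (Suc n))) = matGamma (P + mat (of_nat n) + mat 1)"
    by (simp only: of_nat_Suc mat_add add_ac)
  also have "\<dots> = (P + mat (of_nat n)) ** (matpoch P n ** matGamma P)"
    by (simp add: matGamma_add_one positive_stable_add_nat assms Suc)
  also have "\<dots> = (P + mat (of_nat n)) ** matpoch P n ** matGamma P"
    by (simp add: matrix_mul_assoc)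
  also have "(P + mat (of_nat n)) ** matpoch P n = matpoch P n ** (P + mat (of_nat n))"
    by (intro commute_matpoch commute_add_mat[symmetric] refl)
  finally show ?case by simp
qed simp

lemma commute_matGamma:
  assumes "X ** P = P ** X"
  shows "X ** matGamma P = matGamma P ** X"
  unfolding matGamma_def
  by (intro commute_integral commute_scaleR commute_rpow)
    (simp add: assms matmul.diff_left matmul.diff_right)

text \<open>On an eigenvector t^(P-I) acts as the scalar t^(\<mu>-1), so the matrix integral becomes
  Euler's integral.\<close>

lemma matGamma_eigenvector:
  fixes P :: "complex^'r^'r"
  assumes "positive_stable P" "P *v v = \<mu> *s v" "v \<noteq> 0"
  shows "matGamma P *v v = Gamma \<mu> *s v"
proof -
  have \<mu>: "Re \<mu> > 0"
    using assms unfolding positive_stable_def by blast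
  have ev: "(P - mat 1) *v v = (\<mu> - 1) *s v"
  proof -
    have "mat (- 1) = (- mat 1 :: complex^'r^'r)"
      by (simp add: vec_eq_iff mat_def)
    then show ?thesis
      using eigenvector_add_mat[OF assms(2), of "- 1"] by simp
  qed
  have "(matGamma P *v v) $ i = Gamma \<mu> * v $ i" for i
  proof -
    have "bounded_linear (\<lambda>M. (M *v v) $ i)"
      by (intro bounded_linear_compose[OF bounded_linear_vec_nth bounded_linear_matrix_vector_mult_left])
    from has_integral_linear[OF matGamma_has_integral[OF assms(1)] this]
    have "((\<lambda>t. ((exp (- t) *\<^sub>R rpow t (P - mat 1)) *v v) $ i) has_integral (matGamma P *v v) $ i) {0<..}"
      by (simp add: o_def)
    moreover have "((\<lambda>t. of_real t powr (\<mu> - 1) / of_real (exp t) * v $ i) has_integral Gamma \<mu> * v $ i) {0<..}"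
      by (intro has_integral_mult_left Gamma_integral_complex' \<mu>)
    then have "((\<lambda>t. ((exp (- t) *\<^sub>R rpow t (P - mat 1)) *v v) $ i) has_integral Gamma \<mu> * v $ i) {0<..}"
      by (rule has_integral_eq[rotated])
        (simp add: scaleR_matrix_vector_mult rpow_eigenvector[OF ev],
          simp add: exp_minus scaleR_conv_of_real field_simps)
    ultimately show ?thesis by (rule has_integral_unique)
  qed
  then show ?thesis by (simp add: vec_eq_iff)
qed

text \<open>The kernel of \<open>\<Gamma>(P)\<close> is \<open>P\<close>-invariant, so if it were nonzero it would contain an eigenvector
  of \<open>P\<close>, on which \<open>\<Gamma>(P)\<close> acts as the nonzero scalar \<open>\<Gamma>(\<mu>)\<close>.\<close>

lemma invertible_matGamma:
  fixes P :: "complex^'r^'r"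
  assumes P: "positive_stable P"
  shows "invertible (matGamma P)"
proof (rule ccontr)
  assume "\<not> invertible (matGamma P)"
  then obtain v where v: "v \<noteq> 0" "matGamma P *v v = 0"
    unfolding invertible_iff_ker by blast
  \<comment> \<open>The kernel vector repeated in every column, because the eigenvector extraction
    is phrased for matrices.\<close>
  define X :: "complex^'r^'r" where "X = (\<chi> i j. v $ i)"
  have X: "X \<noteq> 0" "matGamma P ** X = 0"
    using v by (simp_all add: X_def vec_eq_iff matrix_matrix_mult_def matrix_vector_mult_def)
  obtain \<mu>s where "eigenprod P \<mu>s X = 0"
    using positive_stable_eigenprod[OF P] by metis
  then obtain \<mu> and U :: "complex^'r^'r" where U: "U \<noteq> 0" "(P - mat \<mu>) ** U = 0" "matGamma P ** U = 0"
    using eigenprod_kernel_eigenvector[OF _ X commute_matGamma[symmetric]] by blast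
  then obtain j where j: "column j U \<noteq> 0"
    by (auto simp: vec_eq_iff column_def)
  have col: "(M ** U) = 0 \<Longrightarrow> M *v column j U = 0" for M :: "complex^'r^'r"
    by (simp add: vec_eq_iff matrix_matrix_mult_def matrix_vector_mult_def column_def)
  have ev: "P *v column j U = \<mu> *s column j U"
    using col[OF U(2)] by (simp add: matrix_vector_mult_diff_rdistrib mat_vector_mult)
  with P j have "Re \<mu> > 0"
    unfolding positive_stable_def by blast
  \<comment> \<open>\<open>Gamma\<close> is 0 exactly at its poles, by convention, so excluding
    these is all that is required.\<close>
  then have "\<mu> \<notin> \<int>\<^sub>\<le>\<^sub>0"
    by (auto elim!: nonpos_Ints_cases)
  with matGamma_eigenvector[OF P ev j] col[OF U(3)] j show False
    by (simp add: Gamma_eq_zero_iff)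
qed

section \<open>Double exponential generating functions\<close>

text \<open>The coefficients of a double exponential generating function that converges on the unit
  bidisc.\<close>

definition factorial_growth :: "(nat \<Rightarrow> nat \<Rightarrow> 'a::real_normed_vector) \<Rightarrow> bool" where
  "factorial_growth c \<longleftrightarrow> (\<forall>\<rho>. 0 < \<rho> \<and> \<rho> < 1 \<longrightarrow>
    (\<exists>C. \<forall>j k. norm (c j k) * \<rho> ^ (j + k) \<le> C * (fact j * fact k)))"

lemma factorial_growth_flip: "factorial_growth c \<Longrightarrow> factorial_growth (\<lambda>j k. c k j)"
  unfolding factorial_growth_def by (metis (no_types, lifting) add.commute mult.commute)

text \<open>The shift costs a factor k + 1. Since every radius below 1 is allowed, the bound may be
  taken at a larger radius \<rho>', and the geometric gain (\<rho>/\<rho>')^k pays for it.\<close>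

lemma factorial_growth_Suc:
  assumes "factorial_growth c"
  shows "factorial_growth (\<lambda>j k. c j (Suc k))"
  unfolding factorial_growth_def
proof safe
  fix \<rho> :: real assume \<rho>: "0 < \<rho>" "\<rho> < 1"
  define \<rho>' where "\<rho>' = (1 + \<rho>) / 2"
  have \<rho>': "0 < \<rho>'" "\<rho>' < 1" "\<rho> < \<rho>'" using \<rho> by (auto simp: \<rho>'_def)
  define q where "q = \<rho> / \<rho>'"
  have q: "0 < q" "q < 1" using \<rho> \<rho>' by (auto simp: q_def)
  obtain C where C: "\<And>j k. norm (c j k) * \<rho>' ^ (j + k) \<le> C * (fact j * fact k)"
    using assms \<rho>' unfolding factorial_growth_def by blast
  have "((\<lambda>k. real (Suc k) * q ^ k) \<longlongrightarrow> 0) sequentially"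
    using q by real_asymp
  then have "Bseq (\<lambda>k. real (Suc k) * q ^ k)"
    by (intro convergent_imp_Bseq convergentI)
  then obtain K where K: "\<And>k. real (Suc k) * q ^ k \<le> K"
    unfolding Bseq_def by (metis abs_le_D1 real_norm_def)
  have "C \<ge> 0"
    using order_trans[OF _ C[of 0 0]] by simp
  have "norm (c j (Suc k)) * \<rho> ^ (j + k) \<le> C / \<rho>' * K * (fact j * fact k)" for j k
  proof -
    have "norm (c j (Suc k)) * \<rho> ^ (j + k) = norm (c j (Suc k)) * \<rho>' ^ (j + Suc k) * (q ^ k * q ^ j) / \<rho>'"
      using \<rho>' by (simp add: q_def power_divide power_add field_simps)
    also have "\<dots> \<le> C * (fact j * fact (Suc k)) * (q ^ k * 1) / \<rho>'"
      using q \<rho>' \<open>C \<ge> 0\<close> by (intro divide_right_mono mult_mono C order_refl power_le_one) auto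
    also have "\<dots> = C / \<rho>' * (real (Suc k) * q ^ k) * (fact j * fact k)"
      by (simp add: fact_Suc del: of_nat_Suc)
    also have "\<dots> \<le> C / \<rho>' * K * (fact j * fact k)"
      using \<rho>' \<open>C \<ge> 0\<close> by (intro mult_right_mono mult_left_mono K) auto
    finally show ?thesis .
  qed
  then show "\<exists>C. \<forall>j k. norm (c j (Suc k)) * \<rho> ^ (j + k) \<le> C * (fact j * fact k)"
    by blast
qed

lemma factorial_growth_shift:
  assumes "factorial_growth c"
  shows "factorial_growth (\<lambda>j k. c (j + m) (k + n))"
proof -
  have right: "factorial_growth (\<lambda>j k. c j (k + n))" if "factorial_growth c" for c :: "nat \<Rightarrow> nat \<Rightarrow> 'a" and n
  proof (induction n)
    case (Suc n)
    from factorial_growth_Suc[OF this] show ?case by simp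
  qed (simp add: that)
  from right[OF factorial_growth_flip[OF right[OF factorial_growth_flip[OF assms], of m]], of n]
  show ?thesis .
qed

text \<open>A radius strictly between both moduli and 1 leaves a product of two convergent geometric
  series as majorant.\<close>

lemma factorial_growth_abs_summable:
  fixes c :: "nat \<Rightarrow> nat \<Rightarrow> 'a::real_normed_vector"
  assumes c: "factorial_growth c" and z: "norm (z::complex) < 1" "norm (w::complex) < 1"
  shows "(\<lambda>(j, k). norm (z ^ j * w ^ k / (fact j * fact k)) * norm (c j k)) summable_on UNIV"
proof -
  obtain \<rho> where "max (norm z) (norm w) < \<rho>" and \<rho>1: "\<rho> < 1"
    using z dense[of "max (norm z) (norm w)" 1] by auto
  then have \<rho>: "norm z < \<rho>" "norm w < \<rho>" "\<rho> > 0"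
    using le_less_trans[OF norm_ge_zero[of z], of \<rho>] by auto
  obtain C where C: "\<And>j k. norm (c j k) * \<rho> ^ (j + k) \<le> C * (fact j * fact k)"
    using c \<rho>(3) \<rho>1 unfolding factorial_growth_def by blast
  define p q where "p = norm z / \<rho>" and "q = norm w / \<rho>"
  have pq: "0 \<le> p" "p < 1" "0 \<le> q" "q < 1" using \<rho> by (auto simp: p_def q_def)
  have geo: "(\<lambda>k. x ^ k) summable_on UNIV" if "0 \<le> x" "x < 1" for x :: real
    using that by (subst summable_on_UNIV_nonneg_real_iff) (auto intro: summable_geometric)
  have "(\<lambda>(j, k). C * (p ^ j * q ^ k)) summable_on UNIV"
  proof -
    have "(\<lambda>x. norm (p ^ fst x * q ^ snd x)) summable_on (UNIV \<times> UNIV)"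
      using geo[OF pq(1,2)] geo[OF pq(3,4)] pq
      by (subst Infinite_Sum.abs_summable_on_Sigma_iff)
        (auto simp: abs_mult infsum_cmult_right' infsum_nonneg intro: summable_on_cmult_right summable_on_cmult_left)
    then show ?thesis
      using pq by (simp add: case_prod_unfold abs_mult summable_on_cmult_right)
  qed
  then show ?thesis
  proof (rule summable_on_comparison_test)
    fix x :: "nat \<times> nat"
    obtain j k where x: "x = (j, k)" by fastforce
    have "norm (c j k) \<le> C * (fact j * fact k) / \<rho> ^ (j + k)"
      using C[of j k] \<rho> by (simp add: field_simps)
    then have "norm (z ^ j * w ^ k / (fact j * fact k)) * norm (c j k)
        \<le> norm (z ^ j * w ^ k / (fact j * fact k)) * (C * (fact j * fact k) / \<rho> ^ (j + k))"
      by (rule mult_left_mono) auto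
    also have "\<dots> = C * (p ^ j * q ^ k)"
      by (simp add: p_def q_def norm_mult norm_divide norm_power power_divide power_add field_simps)
    finally show "(case x of (j, k) \<Rightarrow> norm (z ^ j * w ^ k / (fact j * fact k)) * norm (c j k))
        \<le> (case x of (j, k) \<Rightarrow> C * (p ^ j * q ^ k))"
      by (simp add: x)
  qed (auto simp: case_prod_unfold)
qed

lemma factorial_growth_summable:
  fixes c :: "nat \<Rightarrow> nat \<Rightarrow> complex^'r^'r"
  assumes "factorial_growth c" and "norm z < 1" "norm w < 1"
  shows "(\<lambda>(j, k). (z ^ j * w ^ k / (fact j * fact k)) *\<^sub>C c j k) summable_on UNIV"
  by (rule Infinite_Sum.abs_summable_summable)
    (use factorial_growth_abs_summable[OF assms] in \<open>simp add: case_prod_unfold norm_cscale\<close>)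

definition double_egf :: "(nat \<Rightarrow> nat \<Rightarrow> complex^'r^'r) \<Rightarrow> complex \<Rightarrow> complex \<Rightarrow> complex^'r^'r" where
  "double_egf c z w = (\<Sum>\<^sub>\<infinity>(j, k)\<in>UNIV. (z ^ j * w ^ k / (fact j * fact k)) *\<^sub>C c j k)"

lemma infsum_flip: "(\<Sum>\<^sub>\<infinity>(j, k)\<in>UNIV. f j k) = (\<Sum>\<^sub>\<infinity>(k, j)\<in>UNIV. f j k)"
proof -
  have "(\<Sum>\<^sub>\<infinity>(j, k)\<in>range prod.swap. f j k) = infsum ((\<lambda>(j, k). f j k) \<circ> prod.swap) UNIV"
    by (rule infsum_reindex) simp
  moreover have "(\<lambda>(j, k). f j k) \<circ> prod.swap = (\<lambda>(k, j). f j k)"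
    by auto
  ultimately show ?thesis by simp
qed

lemma double_egf_flip: "double_egf c z w = double_egf (\<lambda>j k. c k j) w z"
  unfolding double_egf_def
  using infsum_flip[of "\<lambda>j k. (z ^ j * w ^ k / (fact j * fact k)) *\<^sub>C c j k"]
  by (simp only: mult.commute[of "z ^ _"] mult.commute[of "fact _" "fact _"])

lemma eventually_norm_less: "norm (w::complex) < 1 \<Longrightarrow> \<forall>\<^sub>F x in nhds w. norm x < 1"
  using eventually_nhds_in_open[of "ball 0 1" w] by simp

text \<open>Absolute convergence allows summing over j first. What remains is a power series in w,
  to which the classical termwise differentiation applies.\<close>

lemma scalar_double_egf_deriv:
  fixes c :: "nat \<Rightarrow> nat \<Rightarrow> complex"
  assumes c: "factorial_growth c" and z: "norm z < 1" and w: "norm w < 1"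
  shows "((\<lambda>w. \<Sum>\<^sub>\<infinity>(j, k)\<in>UNIV. z ^ j * w ^ k / (fact j * fact k) * c j k) has_field_derivative
    (\<Sum>\<^sub>\<infinity>(j, k)\<in>UNIV. z ^ j * w ^ k / (fact j * fact k) * c j (Suc k))) (at w)"
proof -
  define a where "a c k = (\<Sum>\<^sub>\<infinity>j\<in>UNIV. z ^ j / (fact j * fact k) * c j k)" for c :: "nat \<Rightarrow> nat \<Rightarrow> complex" and k
  have sums: "(\<lambda>k. a c k * w ^ k) sums (\<Sum>\<^sub>\<infinity>(j, k)\<in>UNIV. z ^ j * w ^ k / (fact j * fact k) * c j k)"
    if c: "factorial_growth c" and w: "norm w < 1" for w c
  proof -
    define f where "f k j = z ^ j * w ^ k / (fact j * fact k) * c j k" for k j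
    have "(\<lambda>(k, j). f k j) summable_on UNIV"
      by (rule Infinite_Sum.abs_summable_summable)
        (use factorial_growth_abs_summable[OF factorial_growth_flip[OF c] w z] in
          \<open>simp add: case_prod_unfold f_def norm_mult norm_divide norm_power mult_ac\<close>)
    then have S: "(\<lambda>(k, j). f k j) summable_on UNIV \<times> UNIV" by simp
    have "(\<lambda>k. \<Sum>\<^sub>\<infinity>j\<in>UNIV. f k j) sums (\<Sum>\<^sub>\<infinity>k\<in>UNIV. \<Sum>\<^sub>\<infinity>j\<in>UNIV. f k j)"
      using summable_on_Sigma_banach[OF S] by (intro has_sum_imp_sums has_sum_infsum)
    also have "(\<Sum>\<^sub>\<infinity>k\<in>UNIV. \<Sum>\<^sub>\<infinity>j\<in>UNIV. f k j) = (\<Sum>\<^sub>\<infinity>(j, k)\<in>UNIV. f k j)"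
      using infsum_Sigma'_banach[OF S] by (simp add: infsum_flip[of "\<lambda>j k. f k j"])
    also have "(\<lambda>k. \<Sum>\<^sub>\<infinity>j\<in>UNIV. f k j) = (\<lambda>k. a c k * w ^ k)"
    proof
      fix k
      have "f k j = z ^ j / (fact j * fact k) * c j k * w ^ k" for j
        by (simp add: f_def)
      then show "(\<Sum>\<^sub>\<infinity>j\<in>UNIV. f k j) = a c k * w ^ k"
        by (simp only: a_def infsum_cmult_left')
    qed
    finally show ?thesis by (simp add: f_def)
  qed
  \<comment> \<open>The factor k + 1 from differentiation turns 1/(k+1)! into 1/k!, which leaves a
    pure index shift.\<close>
  have diffs: "diffs (a c) = a (\<lambda>j k. c j (Suc k))"
    by (simp add: fun_eq_iff diffs_def a_def infsum_cmult_right'[symmetric] fact_Suc del: of_nat_Suc)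
  have "((\<lambda>w. \<Sum>k. a c k * w ^ k) has_field_derivative (\<Sum>k. diffs (a c) k * w ^ k)) (at w)"
    by (rule termdiffs_strong'[of 1]) (use sums c w in \<open>auto intro: sums_summable\<close>)
  also have "(\<Sum>k. diffs (a c) k * w ^ k) = (\<Sum>\<^sub>\<infinity>(j, k)\<in>UNIV. z ^ j * w ^ k / (fact j * fact k) * c j (Suc k))"
    unfolding diffs by (rule sums_unique[symmetric]) (rule sums[OF factorial_growth_Suc[OF c] w])
  finally show ?thesis
  \<comment> \<open>The power series and the unordered double sum are only known to agree inside the
    unit disc, which is enough near \<open>w\<close>.\<close>
  proof (rule DERIV_cong_ev[THEN iffD1, rotated -1])
    have "\<forall>\<^sub>F w in nhds w. norm w < 1"
      by (rule eventually_norm_less[OF w])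
    then show "\<forall>\<^sub>F w in nhds w. (\<Sum>k. a c k * w ^ k) = (\<Sum>\<^sub>\<infinity>(j, k)\<in>UNIV. z ^ j * w ^ k / (fact j * fact k) * c j k)"
      by eventually_elim (rule sums_unique[symmetric], rule sums[OF c])
  qed auto
qed

lemma double_egf_nth:
  assumes "factorial_growth c" "norm z < 1" "norm w < 1"
  shows "double_egf c z w $ a $ b = (\<Sum>\<^sub>\<infinity>(j, k)\<in>UNIV. z ^ j * w ^ k / (fact j * fact k) * (c j k $ a $ b))"
proof -
  have "bounded_linear (\<lambda>M :: complex^'a^'a. M $ a $ b)"
    by (intro bounded_linear_compose[OF bounded_linear_vec_nth] bounded_linear_vec_nth)
  from has_sum_bounded_linear[OF this has_sum_infsum[OF factorial_growth_summable[OF assms]]]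
  show ?thesis
    unfolding double_egf_def
    by (intro infsumI[symmetric]) (simp add: case_prod_unfold cscale_eq_mat_mult mat_mult_nth)
qed

lemma double_egf_has_derivative_right:
  fixes c :: "nat \<Rightarrow> nat \<Rightarrow> complex^'r^'r"
  assumes c: "factorial_growth c" and z: "norm z < 1" and w: "norm w < 1"
  shows "(double_egf c z has_derivative (\<lambda>h. h *\<^sub>C double_egf (\<lambda>j k. c j (Suc k)) z w)) (at w)"
proof (intro has_derivative_vecI)
  fix a b
  have "factorial_growth (\<lambda>j k. c j k $ a $ b)"
    unfolding factorial_growth_def
  proof safe
    fix \<rho> :: real assume \<rho>: "0 < \<rho>" "\<rho> < 1"
    then obtain C where C: "\<And>j k. norm (c j k) * \<rho> ^ (j + k) \<le> C * (fact j * fact k)"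
      using c unfolding factorial_growth_def by blast
    have "norm (c j k $ a $ b) * \<rho> ^ (j + k) \<le> norm (c j k) * \<rho> ^ (j + k)" for j k
      using \<rho> by (intro mult_right_mono order_trans[OF Finite_Cartesian_Product.norm_nth_le Finite_Cartesian_Product.norm_nth_le]) auto
    then show "\<exists>C. \<forall>j k. norm (c j k $ a $ b) * \<rho> ^ (j + k) \<le> C * (fact j * fact k)"
      using C order_trans by blast
  qed
  from scalar_double_egf_deriv[OF this z w]
  have "((\<lambda>w. \<Sum>\<^sub>\<infinity>(j, k)\<in>UNIV. z ^ j * w ^ k / (fact j * fact k) * (c j k $ a $ b)) has_field_derivative
      double_egf (\<lambda>j k. c j (Suc k)) z w $ a $ b) (at w)"
    by (simp add: double_egf_nth[OF factorial_growth_Suc[OF c] z w])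
  then have "((\<lambda>w. double_egf c z w $ a $ b) has_field_derivative
      double_egf (\<lambda>j k. c j (Suc k)) z w $ a $ b) (at w)"
    by (rule DERIV_cong_ev[THEN iffD2, rotated -1])
      (use eventually_norm_less[OF w] in \<open>auto elim!: eventually_mono simp: double_egf_nth[OF c z]\<close>)
  then show "((\<lambda>w. double_egf c z w $ a $ b) has_derivative
      (\<lambda>h. (h *\<^sub>C double_egf (\<lambda>j k. c j (Suc k)) z w) $ a $ b)) (at w)"
    by (simp add: has_field_derivative_def cscale_eq_mat_mult mat_mult_nth mult_commute_abs)
qed

lemma double_egf_nth_deriv_right:
  assumes "factorial_growth c" "norm z < 1" "norm w < 1"
  shows "has_nth_deriv n (double_egf c z) w (double_egf (\<lambda>j k. c j (k + n)) z w)"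
  using assms(3)
proof (induction n arbitrary: w)
  case (Suc n)
  have "\<forall>\<^sub>F x in nhds w. has_nth_deriv n (double_egf c z) x (double_egf (\<lambda>j k. c j (k + n)) z x)"
    using eventually_norm_less[OF Suc.prems] by eventually_elim (rule Suc.IH)
  moreover have "factorial_growth (\<lambda>j k. c j (k + n))"
    using factorial_growth_shift[OF assms(1), of 0 n] by simp
  from double_egf_has_derivative_right[OF this assms(2) Suc.prems]
  have "(double_egf (\<lambda>j k. c j (k + n)) z has_derivative
      (\<lambda>h. h *\<^sub>C double_egf (\<lambda>j k. c j (k + Suc n)) z w)) (at w)"
    by simp
  ultimately show ?case by (auto intro!: exI[of _ "double_egf (\<lambda>j k. c j (k + n)) z"])
qed simp

text \<open>The w-derivatives are taken first, for all nearby z. Exchanging the two indices then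
  makes z the second variable, so the same one-variable result applies again.\<close>

lemma double_egf_mixed_partial:
  assumes "factorial_growth c" "norm z < 1" "norm w < 1"
  shows "has_mixed_partial m n (double_egf c) z w (double_egf (\<lambda>j k. c (j + m) (k + n)) z w)"
proof -
  have "\<forall>\<^sub>F x in nhds z. has_nth_deriv n (double_egf c x) w (double_egf (\<lambda>j k. c j (k + n)) x w)"
    using eventually_norm_less[OF assms(2)]
    by eventually_elim (rule double_egf_nth_deriv_right[OF assms(1) _ assms(3)])
  moreover have "factorial_growth (\<lambda>j k. c k (j + n))"
    using factorial_growth_flip[OF factorial_growth_shift[OF assms(1), of 0 n]] by simp
  from double_egf_nth_deriv_right[OF this assms(3,2), of m]
  have "has_nth_deriv m (\<lambda>x. double_egf (\<lambda>j k. c j (k + n)) x w) z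
      (double_egf (\<lambda>j k. c (j + m) (k + n)) z w)"
    by (simp add: double_egf_flip[of "\<lambda>j k. c j (k + n)"] double_egf_flip[of "\<lambda>j k. c (j + m) (k + n)"])
  ultimately show ?thesis
    unfolding has_mixed_partial_def
    by (intro exI[of _ "\<lambda>x. double_egf (\<lambda>j k. c j (k + n)) x w"] conjI)
qed

section \<open>The extended Appell function\<close>

lemma matpoch_add: "matpoch M (m + n) = matpoch M m ** matpoch (M + mat (of_nat m)) n"
  by (induction n) (simp_all add: matrix_mul_assoc mat_add add.assoc)

text \<open>The ratio of consecutive terms is bounded by a sequence tending to \<rho> < 1, so the
  terms are summable and in particular bounded; (1 + \<rho>)/2 is a number strictly between \<rho>
  and 1.\<close>

lemma matpoch_factorial_growth:
  fixes M :: "complex^'r^'r"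
  assumes "0 < \<rho>" "\<rho> < 1"
  obtains C where "\<And>j. norm (matpoch M j) * \<rho> ^ j \<le> C * fact j"
proof -
  define u where "u j = norm (matpoch M j) * \<rho> ^ j / fact j" for j
  define q where "q j = (norm M + real j) * \<rho> / real (Suc j)" for j
  have u0: "u j \<ge> 0" for j using assms by (simp add: u_def)
  have u_Suc: "u (Suc j) \<le> q j * u j" for j
  proof -
    have "norm (matpoch M (Suc j)) * (\<rho> ^ Suc j / fact (Suc j))
        \<le> norm (matpoch M j) * (norm M + real j) * (\<rho> ^ Suc j / fact (Suc j))"
      using assms by (intro mult_right_mono norm_matpoch_Suc_le) auto
    then show ?thesis
      by (simp add: u_def q_def fact_Suc mult_ac del: matpoch.simps of_nat_Suc)
  qed
  have "((\<lambda>j. (b + real j) * \<rho> / real (Suc j)) \<longlongrightarrow> \<rho>) sequentially" for b :: real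
    by real_asymp
  from order_tendstoD(2)[OF this, of "(1 + \<rho>) / 2" "norm M"]
  have "\<forall>\<^sub>F j in sequentially. q j < (1 + \<rho>) / 2"
    using assms by (simp add: q_def)
  then obtain N where N: "\<And>j. j \<ge> N \<Longrightarrow> q j < (1 + \<rho>) / 2"
    by (auto simp: eventually_sequentially)
  have "summable u"
  proof (rule summable_ratio_test[of "(1 + \<rho>) / 2" N])
    fix j assume "j \<ge> N"
    then have "q j * u j \<le> (1 + \<rho>) / 2 * u j"
      by (intro mult_right_mono less_imp_le[OF N] u0)
    then show "norm (u (Suc j)) \<le> (1 + \<rho>) / 2 * norm (u j)"
      using u_Suc[of j] u0[of j] u0[of "Suc j"] by simp
  qed (use assms in simp)
  then have "Bseq u"
    by (intro convergent_imp_Bseq summable_LIMSEQ_zero[THEN convergentI])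
  then obtain C where "\<And>j. u j \<le> C"
    unfolding Bseq_def by (metis abs_le_D1 real_norm_def)
  then show thesis
    by (intro that[of C]) (simp add: u_def divide_simps)
qed

text \<open>Only the Pochhammer factors grow. The constant matrix \<open>G\<close> is left
  arbitrary, so that the original and the shifted Appell function are both covered.\<close>

lemma appell_coeff_factorial_growth:
  "factorial_growth (\<lambda>j k. extBeta A B Y (P + mat (of_nat (j + k))) Q ** G
    ** matpoch B1 j ** matpoch B2 k)"
  unfolding factorial_growth_def
proof safe
  fix \<rho> :: real assume \<rho>: "0 < \<rho>" "\<rho> < 1"
  obtain K where K: "\<And>k. norm (extBeta A B Y (P + mat (of_nat k)) Q) \<le> K"
    by (rule extBeta_add_nat_bounded) blast
  obtain C1 where C1: "\<And>j. norm (matpoch B1 j) * \<rho> ^ j \<le> C1 * fact j"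
    using matpoch_factorial_growth[OF \<rho>] by blast
  obtain C2 where C2: "\<And>j. norm (matpoch B2 j) * \<rho> ^ j \<le> C2 * fact j"
    using matpoch_factorial_growth[OF \<rho>] by blast
  have nonneg: "K \<ge> 0" "C1 \<ge> 0"
    using order_trans[OF norm_ge_zero K] order_trans[OF norm_ge_zero, of "matpoch B1 0" C1] C1[of 0] by simp_all
  have "norm (extBeta A B Y (P + mat (of_nat (j + k))) Q ** G ** matpoch B1 j ** matpoch B2 k) * \<rho> ^ (j + k)
      \<le> K * norm G * C1 * C2 * (fact j * fact k)" for j k
  proof -
    let ?E = "extBeta A B Y (P + mat (of_nat (j + k))) Q"
    have "norm (?E ** G ** matpoch B1 j ** matpoch B2 k) \<le> norm (?E ** G ** matpoch B1 j) * norm (matpoch B2 k)"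
      by (rule norm_matrix_mult_le)
    also have "\<dots> \<le> norm (?E ** G) * norm (matpoch B1 j) * norm (matpoch B2 k)"
      by (intro mult_right_mono norm_matrix_mult_le) auto
    also have "\<dots> \<le> norm ?E * norm G * norm (matpoch B1 j) * norm (matpoch B2 k)"
      by (intro mult_right_mono norm_matrix_mult_le) auto
    also have "\<dots> \<le> K * norm G * norm (matpoch B1 j) * norm (matpoch B2 k)"
      by (intro mult_right_mono K) auto
    finally have "norm (?E ** G ** matpoch B1 j ** matpoch B2 k) * \<rho> ^ (j + k)
        \<le> K * norm G * norm (matpoch B1 j) * norm (matpoch B2 k) * \<rho> ^ (j + k)"
      using \<rho> by (intro mult_right_mono) auto
    also have "\<dots> = K * norm G * ((norm (matpoch B1 j) * \<rho> ^ j) * (norm (matpoch B2 k) * \<rho> ^ k))"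
      by (simp add: power_add)
    also have "\<dots> \<le> K * norm G * ((C1 * fact j) * (C2 * fact k))"
      using \<rho> nonneg by (intro mult_left_mono mult_mono C1 C2) auto
    finally show ?thesis by (simp add: mult_ac)
  qed
  then show "\<exists>C. \<forall>j k. norm (extBeta A B Y (P + mat (of_nat (j + k))) Q ** G
      ** matpoch B1 j ** matpoch B2 k) * \<rho> ^ (j + k) \<le> C * (fact j * fact k)"
    by blast
qed

section \<open>The beta matrix function under integer shifts\<close>

lemma commute_matBeta:
  assumes "positive_stable (P + Q)" "X ** P = P ** X" "X ** Q = Q ** X"
  shows "X ** matBeta P Q = matBeta P Q ** X"
  unfolding matBeta_def
  by (intro commute_mult commute_matrix_inv commute_matGamma commute_add invertible_matGamma assms)

lemma invertible_matBeta:
  assumes "positive_stable P" "positive_stable Q" "positive_stable (P + Q)"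
  shows "invertible (matBeta P Q)"
  unfolding matBeta_def
  by (intro invertible_mult invertible_matrix_inv invertible_matGamma assms)

text \<open>The shift touches \<Gamma>(P) and \<Gamma>(P + Q). Inverting the second leaves the
  inverse Pochhammer symbol on the far right, and it moves left because the beta matrix commutes
  with P + Q.\<close>

lemma matBeta_add_nat:
  fixes P Q :: "complex^'r^'r"
  assumes P: "positive_stable P" and PQ: "positive_stable (P + Q)" and comm: "P ** Q = Q ** P"
  shows "matBeta (P + mat (of_nat n)) Q
    = matpoch P n ** matrix_inv (matpoch (P + Q) n) ** matBeta P Q"
proof -
  define S where "S = P + Q"
  have S: "positive_stable S" using PQ by (simp add: S_def)
  have "S ** P = P ** S" "S ** Q = Q ** S"
    by (simp_all add: S_def matmul.add_left matmul.add_right comm)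
  then have "matBeta P Q ** S = S ** matBeta P Q"
    using S by (intro commute_matBeta[symmetric]) (simp_all add: S_def)
  then have SB: "matBeta P Q ** matrix_inv (matpoch S n) = matrix_inv (matpoch S n) ** matBeta P Q"
    by (intro commute_matrix_inv commute_matpoch invertible_matpoch S)
  have shift: "P + mat (of_nat n) + Q = S + mat (of_nat n)"
    by (simp add: S_def)
  have "matBeta (P + mat (of_nat n)) Q = matpoch P n ** matGamma P ** matGamma Q
      ** (matrix_inv (matGamma S) ** matrix_inv (matpoch S n))"
    unfolding matBeta_def shift
    by (simp add: matGamma_add_nat P S matrix_inv_mult invertible_matpoch invertible_matGamma)
  also have "\<dots> = matpoch P n ** (matBeta P Q ** matrix_inv (matpoch S n))"
    by (simp only: matBeta_def S_def matrix_mul_assoc)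
  also have "\<dots> = matpoch P n ** (matrix_inv (matpoch S n) ** matBeta P Q)"
    by (simp only: SB)
  finally show ?thesis
    by (simp only: S_def matrix_mul_assoc)
qed

lemma matrix_inv_matBeta_add_nat:
  fixes P Q :: "complex^'r^'r"
  assumes P: "positive_stable P" and Q: "positive_stable Q" and PQ: "positive_stable (P + Q)"
    and comm: "P ** Q = Q ** P"
  shows "matpoch P n ** matrix_inv (matpoch (P + Q) n) ** matrix_inv (matBeta (P + mat (of_nat n)) Q)
    = matrix_inv (matBeta P Q)"
proof -
  define X where "X = matpoch P n ** matrix_inv (matpoch (P + Q) n)"
  have X: "invertible X"
    unfolding X_def by (intro invertible_mult invertible_matrix_inv invertible_matpoch P PQ)
  have B: "invertible (matBeta P Q)"
    by (intro invertible_matBeta assms)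
  have "matBeta P Q ** P = P ** matBeta P Q"
    by (rule commute_matBeta[symmetric]) (simp_all add: PQ comm)
  moreover have "matBeta P Q ** (P + Q) = (P + Q) ** matBeta P Q"
    by (rule commute_matBeta[symmetric]) (simp_all add: PQ comm matmul.add_left matmul.add_right)
  ultimately have "matBeta P Q ** X = X ** matBeta P Q"
    unfolding X_def
    by (intro commute_mult commute_matrix_inv commute_matpoch invertible_matpoch PQ)
  then have "matBeta (P + mat (of_nat n)) Q = matBeta P Q ** X"
    by (simp add: matBeta_add_nat[OF P PQ comm] X_def)
  then have "X ** matrix_inv (matBeta (P + mat (of_nat n)) Q) = X ** matrix_inv X ** matrix_inv (matBeta P Q)"
    by (simp add: matrix_inv_mult X B matrix_mul_assoc)
  then show ?thesis
    by (simp add: matrix_inv_right X) (simp add: X_def)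
qed

lemma double_egf_mult:
  fixes c :: "nat \<Rightarrow> nat \<Rightarrow> complex^'r^'r"
  assumes "factorial_growth c" "norm z < 1" "norm w < 1"
  shows "X ** double_egf c z w ** R = double_egf (\<lambda>j k. X ** c j k ** R) z w"
proof -
  have "bounded_linear (\<lambda>M. X ** M ** R)"
    by (intro bounded_linear_compose[OF matmul.bounded_linear_left matmul.bounded_linear_right])
  from has_sum_bounded_linear[OF this has_sum_infsum[OF factorial_growth_summable[OF assms]]]
  show ?thesis
    unfolding double_egf_def
    by (intro infsumI[symmetric])
      (simp add: case_prod_unfold cscale_eq_mat_mult mat_mult_left_commute matrix_mul_assoc[symmetric])
qed

theorem theorem5p4:
  fixes A A1 B B1 B2 C1 Y :: "complex^'r^'r"
    and m n :: nat and z w :: complex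
  assumes "positive_stable A" "positive_stable A1" "positive_stable B" "positive_stable B1"
    "positive_stable B2" "positive_stable C1" "positive_stable (C1 - A1)" "positive_stable Y"
    and "\<And>M N. M \<in> {A, A1, B, C1, Y} \<Longrightarrow> N \<in> {A, A1, B, C1, Y} \<Longrightarrow> M ** N = N ** M"
    and "B1 ** B2 = B2 ** B1"
    and "norm z < 1" "norm w < 1"
  shows "has_mixed_partial m n (\<lambda>z w. extF1 A B A1 B1 B2 C1 z w Y) z w
    (matpoch A1 (m + n) ** matrix_inv (matpoch C1 (m + n))
      ** extF1 A B (A1 + mat (of_nat (m + n))) (B1 + mat (of_nat m)) (B2 + mat (of_nat n))
           (C1 + mat (of_nat (m + n))) z w Y
      ** matpoch B1 m ** matpoch B2 n)"
proof -
  define N where "N = m + n"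
  define Q where "Q = C1 - A1"
  define X where "X = matpoch A1 N ** matrix_inv (matpoch C1 N)"
  define E where "E k = extBeta A B Y (A1 + mat (of_nat k)) Q" for k
  define c where "c j k = E (j + k) ** matrix_inv (matBeta A1 Q) ** matpoch B1 j ** matpoch B2 k" for j k
  define c' where "c' j k = extBeta A B Y (A1 + mat (of_nat N) + mat (of_nat (j + k))) Q
    ** matrix_inv (matBeta (A1 + mat (of_nat N)) Q)
    ** matpoch (B1 + mat (of_nat m)) j ** matpoch (B2 + mat (of_nat n)) k" for j k
  have comm: "M ** M' = M' ** M" if "M \<in> {A, A1, B, C1, Y}" "M' \<in> {A, A1, B, C1, Y}" for M M'
    using assms(9) that .
  have C1_eq: "C1 = A1 + Q" by (simp add: Q_def)
  have A1Q: "A1 ** Q = Q ** A1"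
    by (simp add: Q_def matmul.diff_left matmul.diff_right comm[of A1 C1])
  \<comment> \<open>This lets the prefactor of the theorem cross the extended beta value and meet
    the inverse beta factor behind it.\<close>
  have EX: "E k ** X = X ** E k" for k
  proof -
    have "E k ** M = M ** E k" if "M \<in> {A1, C1}" for M
      unfolding E_def
    proof (rule commute_extBeta[symmetric])
      show "M ** (A1 + mat (of_nat k)) = (A1 + mat (of_nat k)) ** M"
        by (intro commute_add_mat comm) (use that in auto)
      show "M ** Q = Q ** M"
        using that comm[of M A1] comm[of M C1] by (auto simp: Q_def matmul.diff_left matmul.diff_right)
    qed (use that assms(3) in \<open>auto intro: comm\<close>)
    then show ?thesis
      unfolding X_def
      by (intro commute_mult commute_matrix_inv commute_matpoch invertible_matpoch assms(6)) auto
  qed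
  have Xinv: "X ** matrix_inv (matBeta (A1 + mat (of_nat N)) Q) = matrix_inv (matBeta A1 Q)"
    unfolding X_def C1_eq
    by (rule matrix_inv_matBeta_add_nat) (use assms A1Q in \<open>simp_all add: Q_def\<close>)
  have coeff: "X ** c' j k ** (matpoch B1 m ** matpoch B2 n) = c (j + m) (k + n)" for j k
  proof -
    define G where "G = matrix_inv (matBeta (A1 + mat (of_nat N)) Q)"
    define b1 b2 where "b1 = matpoch (B1 + mat (of_nat m)) j" and "b2 = matpoch (B2 + mat (of_nat n)) k"
    have b1: "matpoch B1 (j + m) = b1 ** matpoch B1 m"
      unfolding b1_def add.commute[of j m] matpoch_add
      by (intro commute_matpoch commute_add_mat commute_matpoch[symmetric] refl)
    have b2: "matpoch B2 (k + n) = b2 ** matpoch B2 n"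
      unfolding b2_def add.commute[of k n] matpoch_add
      by (intro commute_matpoch commute_add_mat commute_matpoch[symmetric] refl)
    \<comment> \<open>The one crossing among the right-hand factors: (B1)_m has to pass (B2 + n I)_k
      to join its own kind, which is what commutation of \<open>B1\<close> and \<open>B2\<close>
      provides.\<close>
    have b21: "b2 ** matpoch B1 m = matpoch B1 m ** b2"
      unfolding b2_def
      by (intro commute_matpoch commute_matpoch[symmetric] commute_add_mat assms(10))
    have E': "extBeta A B Y (A1 + mat (of_nat N) + mat (of_nat (j + k))) Q = E (j + m + (k + n))"
      by (simp add: E_def N_def mat_add add_ac)
    have "X ** c' j k ** (matpoch B1 m ** matpoch B2 n)
        = (X ** E (j + m + (k + n))) ** G ** b1 ** (b2 ** matpoch B1 m) ** matpoch B2 n"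
      by (simp only: c'_def E' G_def b1_def b2_def matrix_mul_assoc)
    also have "\<dots> = E (j + m + (k + n)) ** (X ** G) ** (b1 ** matpoch B1 m) ** (b2 ** matpoch B2 n)"
      by (simp only: EX[symmetric] b21 matrix_mul_assoc)
    also have "\<dots> = c (j + m) (k + n)"
      by (simp only: c_def b1 b2 Xinv G_def)
    finally show ?thesis .
  qed
  have F: "extF1 A B A1 B1 B2 C1 z w Y = double_egf c z w" for z w
    unfolding extF1_def double_egf_def c_def E_def Q_def ..
  \<comment> \<open>Shifting \<open>A1\<close> and \<open>C1\<close> together leaves the second beta
    argument fixed, so both functions draw on the same family of extended beta values.\<close>
  have Q': "C1 + mat (of_nat N) - (A1 + mat (of_nat N)) = Q"
    by (simp add: Q_def)
  have F': "extF1 A B (A1 + mat (of_nat N)) (B1 + mat (of_nat m)) (B2 + mat (of_nat n))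
      (C1 + mat (of_nat N)) z w Y = double_egf c' z w"
    unfolding extF1_def double_egf_def c'_def Q' ..
  have growth: "factorial_growth c" "factorial_growth c'"
    unfolding c_def E_def c'_def by (rule appell_coeff_factorial_growth)+
  have "has_mixed_partial m n (double_egf c) z w (double_egf (\<lambda>j k. c (j + m) (k + n)) z w)"
    by (rule double_egf_mixed_partial[OF growth(1) assms(11,12)])
  also have "double_egf (\<lambda>j k. c (j + m) (k + n)) z w = X ** double_egf c' z w ** (matpoch B1 m ** matpoch B2 n)"
    by (simp add: double_egf_mult[OF growth(2) assms(11,12)] coeff)
  finally show ?thesis
    by (simp only: F F'[unfolded N_def] X_def N_def matrix_mul_assoc)
qed

end
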